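(* For every positive integer $n$, the 2-page crossing number of the complete graph satisfies \[ \nu_2(K_n)=Z(n):=\frac14\left\lfloor\frac n2\right\rfloor\left\lfloor\frac{n-1}2\right\rfloor\left\lfloor\frac{n-2}2\right\rfloor\left\lfloor\frac{n-3}2\right\rfloor . \]
   Context: A 2-page book drawing of a graph is a drawing in the plane in which all vertices lie on a line (the spine) and each edge is a simple arc contained entirely in one of the two closed half-planes (pages) determined by the spine. The 2-page crossing number $\nu_2(G)$ is the minimum number of crossings over all 2-page book drawings of $G$ (a crossing being a pair consisting of a point and two distinct edges whose arcs both pass through that point). *)

theory Defs
  imports "HOL-Analysis.Analysis"
begin

text \<open>The plane is modelled as the complex numbers; the spine is the real axis.
  The two pages are the closed upper and lower half-planes.
  The complete graph K_n has vertex set {0..<n}; its edges are the 2-element sets.\<close>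

definition Kn_edges :: "nat \<Rightarrow> nat set set" where
  "Kn_edges n = {{i, j} | i j. i < n \<and> j < n \<and> i \<noteq> j}"

definition page :: "bool \<Rightarrow> complex set" where
  "page b = (if b then {z. Im z \<ge> 0} else {z. Im z \<le> 0})"

definition two_page_drawing ::
  "nat \<Rightarrow> (nat \<Rightarrow> real) \<Rightarrow> (nat set \<Rightarrow> real \<Rightarrow> complex) \<Rightarrow> (nat set \<Rightarrow> bool) \<Rightarrow> bool" where
  "two_page_drawing n pos g pg \<longleftrightarrow>
     inj_on pos {..<n} \<and>
     (\<forall>e\<in>Kn_edges n.
        arc (g e) \<and>
        path_image (g e) \<subseteq> page (pg e) \<and>
        (\<exists>i j. e = {i, j} \<and> pathstart (g e) = complex_of_real (pos i)
                          \<and> pathfinish (g e) = complex_of_real (pos j)) \<and>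
        path_image (g e) \<inter> (\<lambda>v. complex_of_real (pos v)) ` {..<n}
          = {pathstart (g e), pathfinish (g e)})"

definition arc_interior :: "(real \<Rightarrow> complex) \<Rightarrow> complex set" where
  "arc_interior \<gamma> = path_image \<gamma> - {pathstart \<gamma>, pathfinish \<gamma>}"

definition crossings :: "nat \<Rightarrow> (nat set \<Rightarrow> real \<Rightarrow> complex) \<Rightarrow> (complex \<times> nat set set) set" where
  "crossings n g = {(p, {e, f}) | p e f. e \<in> Kn_edges n \<and> f \<in> Kn_edges n \<and> e \<noteq> f \<and>
                       p \<in> arc_interior (g e) \<and> p \<in> arc_interior (g f)}"

definition nu2_complete :: "nat \<Rightarrow> nat" where
  "nu2_complete n = (LEAST k. \<exists>pos g pg. two_page_drawing n pos g pg \<and>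
                         finite (crossings n g) \<and> card (crossings n g) = k)"

end

theory Submission
  imports Defs
begin

text \<open>Two edges on the same page whose ends alternate along the spine must cross, and if all edges
  are parabolic arcs over the integer points there are no other crossings. So the problem is to
  minimise, over 2-colourings of the pairs from \<open>{..<n}\<close>, the number of quadruples
  \<open>a < b < c < d\<close> for which \<open>ac\<close> and \<open>bd\<close> have the same colour.

  Lower bound (following Abrego, Aichholzer, Fernandez-Merchant, Ramos and Salazar): let an edge
  \<open>e\<close> have \<open>L e\<close> vertices on its left and \<open>R e\<close> on its right. A crossing quadruple contributes 2
  and a noncrossing one 3 separations of two vertices by an edge, hence
  \<open>\<Sum>e. L e * R e = 3 (n choose 4) - cr\<close>. Since \<open>L e + R e = n - 2\<close>, the product is a constant minus a
  nonnegative combination of the truncated differences \<open>(t - L e) + (t - R e)\<close>. Deleting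
  the last vertex shows by induction that these sum to at least \<open>3 (t + 2 choose 3)\<close>: the edges at
  that vertex contribute twice \<open>t + 1 choose 2\<close>, and at least \<open>t + 1 choose 2\<close> other edges lose a
  vertex only on their larger side.

  Upper bound: colour \<open>ij\<close> according to whether \<open>(i + j + h) mod n\<close> is in the lower half of the
  residues, and average over \<open>h\<close>.\<close>

subsection \<open>Sides of edges in a 2-coloured ordered complete graph\<close>

text \<open>For \<open>i < j\<close>, \<open>orient \<kappa> i j l\<close> says that \<open>l\<close> lies to the left of the edge from \<open>i\<close> to \<open>j\<close> when
  \<open>\<kappa> a b\<close> means that the edge \<open>ab\<close> (\<open>a < b\<close>) is drawn in the upper page: a triangle
  \<open>a < b < c\<close> is traversed counterclockwise iff its longest edge \<open>ac\<close> is in the upper page.\<close>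

definition orient :: "(nat \<Rightarrow> nat \<Rightarrow> bool) \<Rightarrow> nat \<Rightarrow> nat \<Rightarrow> nat \<Rightarrow> bool" where
  "orient \<kappa> i j l = (if l < i then \<kappa> l j else if l < j then \<not> \<kappa> i j else \<kappa> i l)"

definition side_set :: "(nat \<Rightarrow> nat \<Rightarrow> bool) \<Rightarrow> bool \<Rightarrow> nat \<Rightarrow> nat \<Rightarrow> nat \<Rightarrow> nat set" where
  "side_set \<kappa> x n i j = {l. l < n \<and> l \<noteq> i \<and> l \<noteq> j \<and> orient \<kappa> i j l = x}"

abbreviation side :: "(nat \<Rightarrow> nat \<Rightarrow> bool) \<Rightarrow> bool \<Rightarrow> nat \<Rightarrow> nat \<Rightarrow> nat \<Rightarrow> nat" where
  "side \<kappa> x n i j \<equiv> card (side_set \<kappa> x n i j)"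

definition mono_quads :: "nat \<Rightarrow> (nat \<Rightarrow> nat \<Rightarrow> bool) \<Rightarrow> (nat \<times> nat \<times> nat \<times> nat) set" where
  "mono_quads n \<kappa> = {(a, b, c, d). a < b \<and> b < c \<and> c < d \<and> d < n \<and> \<kappa> a c = \<kappa> b d}"

definition quads :: "nat \<Rightarrow> (nat \<times> nat \<times> nat \<times> nat) set" where
  "quads n = {(a, b, c, d). a < b \<and> b < c \<and> c < d \<and> d < n}"

lemma finite_side_set [simp]: "finite (side_set \<kappa> x n i j)"
  by (simp add: side_set_def)

lemma finite_quads [simp]: "finite (quads n)"
proof (rule finite_subset)
  show "quads n \<subseteq> {..<n} \<times> {..<n} \<times> {..<n} \<times> {..<n}"
    by (auto simp: quads_def)
qed auto

lemma mono_quads_subset: "mono_quads n \<kappa> \<subseteq> quads n"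
  by (auto simp: quads_def mono_quads_def)

lemma finite_mono_quads [simp]: "finite (mono_quads n \<kappa>)"
  using mono_quads_subset finite_quads by (rule finite_subset)

lemma side_add_side:
  assumes "i < j" "j < n"
  shows "side \<kappa> True n i j + side \<kappa> False n i j = n - 2"
proof -
  have "side \<kappa> True n i j + side \<kappa> False n i j = card (side_set \<kappa> True n i j \<union> side_set \<kappa> False n i j)"
    by (subst card_Un_disjoint) (auto simp: side_set_def)
  also have "side_set \<kappa> True n i j \<union> side_set \<kappa> False n i j = {..<n} - {i, j}"
    by (auto simp: side_set_def)
  also have "card \<dots> = n - 2"
    using assms by (subst card_Diff_subset) auto
  finally show ?thesis .
qed

text \<open>For \<open>l = v\<close> beyond \<open>j\<close> the last branch of
  \<open>orient\<close> applies and does not mention \<open>j\<close>: the new last vertex lies on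
  the same side of all edges with left end \<open>i\<close>.\<close>

lemma side_Suc:
  assumes "i < j" "j < v"
  shows "side \<kappa> x (Suc v) i j = side \<kappa> x v i j + of_bool (\<kappa> i v = x)"
proof -
  have "side_set \<kappa> x (Suc v) i j = side_set \<kappa> x v i j \<union> (if \<kappa> i v = x then {v} else {})"
    using assms by (auto simp: side_set_def orient_def less_Suc_eq)
  moreover have "v \<notin> side_set \<kappa> x v i j"
    by (simp add: side_set_def)
  ultimately show ?thesis by simp
qed

lemma bij_betw_rank:
  fixes A :: "nat set"
  assumes "finite A"
  shows "bij_betw (\<lambda>j. card {l \<in> A. l < j}) A {..<card A}"
proof -
  let ?r = "\<lambda>j. card {l \<in> A. l < j}"
  have less: "?r j < ?r k" if "j \<in> A" "j < k" for j k
    using that assms by (intro psubset_card_mono) auto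
  have "inj_on ?r A"
    by (rule linorder_inj_onI) (use less in \<open>force+\<close>)
  moreover have "?r ` A \<subseteq> {..<card A}"
    using assms by (auto intro!: psubset_card_mono)
  ultimately show ?thesis
    by (simp add: bij_betw_def card_image card_subset_eq)
qed

lemma bij_betw_corank:
  fixes A :: "nat set"
  assumes "finite A"
  shows "bij_betw (\<lambda>j. card {l \<in> A. j < l}) A {..<card A}"
proof -
  let ?r = "\<lambda>j. card {l \<in> A. j < l}"
  have less: "?r k < ?r j" if "k \<in> A" "j < k" for j k
    using that assms by (intro psubset_card_mono) auto
  have "inj_on ?r A"
    by (rule linorder_inj_onI) (use less in \<open>force+\<close>)
  moreover have "?r ` A \<subseteq> {..<card A}"
    using assms by (auto intro!: psubset_card_mono)
  ultimately show ?thesis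
    by (simp add: bij_betw_def card_image card_subset_eq)
qed

lemma card_bij_betw_less:
  fixes r :: "nat \<Rightarrow> nat"
  assumes "bij_betw r A {..<m}"
  shows "card {j \<in> A. r j < s} = min s m"
proof -
  have inj: "inj_on r {j \<in> A. r j < s}"
    using assms by (auto simp: bij_betw_def intro: inj_on_subset)
  have "r ` {j \<in> A. r j < s} = r ` A \<inter> {..<s}" by auto
  also have "\<dots> = {..<min s m}"
    using assms by (auto simp: bij_betw_def)
  finally show ?thesis using card_image[OF inj] by simp
qed

text \<open>The edges \<open>ij\<close> of colour \<open>x\<close>, read from the right, and then those of the other colour, read
  from the left, have at most \<open>i, i + 1, i + 2, \<dots>\<close> vertices on side \<open>x\<close>.\<close>

lemma card_row_side_ge:
  assumes "i \<le> t" "t + 2 \<le> v"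
  shows "t + 1 - i \<le> card {j. i < j \<and> j < v \<and> side \<kappa> x v i j \<le> t}"
proof -
  define D where "D = {j. i < j \<and> j < v \<and> \<kappa> i j = x}"
  define U where "U = {j. i < j \<and> j < v \<and> \<kappa> i j \<noteq> x}"
  have fin: "finite D" "finite U" and disj: "D \<inter> U = {}"
    by (auto simp: D_def U_def)
  have "card D + card U = card (D \<union> U)"
    using fin disj by (simp add: card_Un_disjoint)
  also have "D \<union> U = {i<..<v}" by (auto simp: D_def U_def)
  finally have cardDU: "card D + card U = v - i - 1" by simp
  have sideD: "side \<kappa> x v i j \<le> i + card {l \<in> D. j < l}" if "j \<in> D" for j
  proof -
    have "side_set \<kappa> x v i j \<subseteq> {..<i} \<union> {l \<in> D. j < l}"
      using that by (auto simp: side_set_def orient_def D_def split: if_splits)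
    then have "side \<kappa> x v i j \<le> card ({..<i} \<union> {l \<in> D. j < l})"
      using fin by (intro card_mono) auto
    also have "\<dots> \<le> i + card {l \<in> D. j < l}"
      using card_Un_le[of "{..<i}"] by simp
    finally show ?thesis .
  qed
  have sideU: "side \<kappa> x v i j \<le> i + card D + card {l \<in> U. l < j}" if "j \<in> U" for j
  proof -
    have "side_set \<kappa> x v i j \<subseteq> ({..<i} \<union> D) \<union> {l \<in> U. l < j}"
      using that by (auto simp: side_set_def orient_def D_def U_def split: if_splits)
    then have "side \<kappa> x v i j \<le> card (({..<i} \<union> D) \<union> {l \<in> U. l < j})"
      using fin by (intro card_mono) auto
    also have "\<dots> \<le> card ({..<i} \<union> D) + card {l \<in> U. l < j}"
      by (rule card_Un_le)
    also have "\<dots> \<le> i + card D + card {l \<in> U. l < j}"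
      using card_Un_le[of "{..<i}" D] by simp
    finally show ?thesis .
  qed
  let ?D = "{j \<in> D. card {l \<in> D. j < l} < t + 1 - i}"
  let ?U = "{j \<in> U. card {l \<in> U. l < j} < t + 1 - i - card D}"
  \<comment> \<open>The \<open>t + 1 - i\<close> places are filled first from \<open>D\<close>, then
    from \<open>U\<close>; the truncated subtraction asks nothing of \<open>U\<close> when
    \<open>D\<close> suffices. There are enough edges, since \<open>t + 2 \<le> v\<close> gives
    \<open>v - i - 1 \<ge> t + 1 - i\<close>.\<close>
  have "t + 1 - i \<le> card ?D + card ?U"
    using card_bij_betw_less[OF bij_betw_corank[OF fin(1)], of "t + 1 - i"]
      card_bij_betw_less[OF bij_betw_rank[OF fin(2)], of "t + 1 - i - card D"]
      cardDU assms by (auto simp: min_def)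
  also have "\<dots> = card (?D \<union> ?U)"
    using fin disj by (subst card_Un_disjoint) auto
  also have "\<dots> \<le> card {j. i < j \<and> j < v \<and> side \<kappa> x v i j \<le> t}"
  proof (rule card_mono)
    show "?D \<union> ?U \<subseteq> {j. i < j \<and> j < v \<and> side \<kappa> x v i j \<le> t}"
    proof
      fix j assume j: "j \<in> ?D \<union> ?U"
      then have "side \<kappa> x v i j \<le> t"
        using sideD[of j] sideU[of j] by auto
      with j show "j \<in> {j. i < j \<and> j < v \<and> side \<kappa> x v i j \<le> t}"
        by (auto simp: D_def U_def)
    qed
  qed auto
  finally show ?thesis .
qed

text \<open>Let \<open>q\<close> edges at \<open>v\<close> have colour \<open>x\<close>. Read from
  the left, they have \<open>0, 1, ..., q - 1\<close> vertices on side \<open>x\<close>; the other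
  edges, read from the right, have \<open>q, q + 1, ...\<close>. So no value repeats.\<close>

lemma inj_on_side_last: "inj_on (\<lambda>i. side \<kappa> x (Suc v) i v) {..<v}"
proof -
  define A where "A k = {l. l < k \<and> \<kappa> l v = x}" for k
  have finA [simp]: "finite (A k)" for k by (simp add: A_def)
  have s1: "side \<kappa> x (Suc v) i v = card (A i)" if "i < v" "\<kappa> i v = x" for i
    using that by (intro arg_cong[where f = card]) (auto simp: A_def side_set_def orient_def)
  have s2: "side \<kappa> x (Suc v) i v = card (A i) + (v - 1 - i)" if "i < v" "\<kappa> i v \<noteq> x" for i
  proof -
    have "side_set \<kappa> x (Suc v) i v = A i \<union> {i<..<v}"
      using that by (auto simp: A_def side_set_def orient_def)
    moreover have "card (A i \<union> {i<..<v}) = card (A i) + card {i<..<v}"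
      by (rule card_Un_disjoint) (auto simp: A_def)
    ultimately show ?thesis by simp
  qed
  have up: "card (A i) < card (A k)" if "i < k" "\<kappa> i v = x" for i k
    using that by (intro psubset_card_mono) (auto simp: A_def)
  have mono: "card (A k) \<le> card (A i) + (k - i - 1)" if "i < k" "\<kappa> i v \<noteq> x" for i k
  proof -
    have "A k \<subseteq> A i \<union> {i<..<k}"
    proof
      fix l assume "l \<in> A k"
      moreover from this have "l \<noteq> i" using that by (auto simp: A_def)
      ultimately show "l \<in> A i \<union> {i<..<k}" by (auto simp: A_def)
    qed
    then have "card (A k) \<le> card (A i \<union> {i<..<k})"
      by (intro card_mono) auto
    also have "\<dots> \<le> card (A i) + card {i<..<k}" by (rule card_Un_le)
    finally show ?thesis by simp
  qed
  have "side \<kappa> x (Suc v) i v \<noteq> side \<kappa> x (Suc v) k v" if "i < k" "k < v" for i k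
  proof (cases "\<kappa> i v = x")
    case True
    then show ?thesis
      using up[OF that(1)] s1[of i] s1[of k] s2[of k] that by (cases "\<kappa> k v = x") auto
  next
    case False
    then show ?thesis
      using mono[OF that(1)] mono[of i v] up[of k v] s2[of i] s1[of k] s2[of k] that
      by (cases "\<kappa> k v = x") auto
  qed
  then show ?thesis
    by (intro linorder_inj_onI) auto
qed

lemma double_sum_diff_nat: "2 * (\<Sum>t\<le>M. t - (L::nat)) = (M - L) * (M - L + 1)"
proof (induction M)
  case (Suc M)
  show ?case
  proof (cases "L \<le> M")
    case True
    then obtain d where "M = L + d" using le_Suc_ex by blast
    with Suc show ?thesis by (simp add: algebra_simps)
  next
    case False
    with Suc show ?thesis by (cases "L = Suc M") auto
  qed
qed simp

lemma double_sum_codiff_nat: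
  assumes "s \<le> v"
  shows "2 * (\<Sum>w<v. s - w) = s * (s + (1::nat))"
proof -
  have "(\<Sum>w<v. s - w) = (\<Sum>w<s. s - w)"
    using assms by (intro sum.mono_neutral_right) auto
  also have "2 * \<dots> = s * (s + 1)"
  proof (induction s)
    case (Suc s)
    have "(\<Sum>w<Suc s. Suc s - w) = Suc s + (\<Sum>w<s. s - w)"
      by (subst sum.lessThan_Suc_shift) simp
    with Suc show ?case by simp
  qed simp
  finally show ?thesis .
qed

text \<open>The values in \<open>inj_on_side_last\<close> are below \<open>v\<close>, hence a
  permutation of \<open>{..<v}\<close>: the contribution of the edges at the last vertex is
  independent of the colouring.\<close>

lemma sum_side_last:
  assumes "s \<le> v"
  shows "2 * (\<Sum>i<v. s - side \<kappa> x (Suc v) i v) = s * (s + 1)"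
proof -
  let ?f = "\<lambda>i. side \<kappa> x (Suc v) i v"
  have "?f i < v" if "i < v" for i
  proof -
    have "side_set \<kappa> x (Suc v) i v \<subseteq> {..<v} - {i}"
      by (auto simp: side_set_def)
    then have "?f i \<le> card ({..<v} - {i})" by (intro card_mono) auto
    then show ?thesis using that by simp
  qed
  then have "?f ` {..<v} = {..<v}"
    by (intro endo_inj_surj inj_on_side_last) auto
  then have "(\<Sum>i<v. s - ?f i) = (\<Sum>w<v. s - w)"
    using sum.reindex[OF inj_on_side_last[of \<kappa> x v], of "\<lambda>w. s - w"] by simp
  then show ?thesis using double_sum_codiff_nat[OF assms] by simp
qed

text \<open>If \<open>2 * t \<le> n - 2\<close>, at most one of the two truncated differences is nonzero, and this is the
  double partial sum \<open>\<Sum>j<t. \<Sum>k\<le>j. E k\<close>, where \<open>E k\<close> counts the edges with exactly \<open>k\<close> vertices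
  on one side.\<close>

definition side_excess :: "(nat \<Rightarrow> nat \<Rightarrow> bool) \<Rightarrow> nat \<Rightarrow> nat \<Rightarrow> nat" where
  "side_excess \<kappa> n t = (\<Sum>i<n. \<Sum>j\<in>{i<..<n}. (t - side \<kappa> True n i j) + (t - side \<kappa> False n i j))"

text \<open>Vertex count and threshold grow together: the side of \<open>ij\<close> that gains
  \<open>v\<close> keeps its truncated difference, while the difference on the other side,
  \<open>\<not> \<kappa> i v\<close>, grows by 1 exactly when that side has at most \<open>t\<close>
  vertices. The edges at \<open>v\<close> come on top.\<close>

lemma side_excess_Suc:
  "side_excess \<kappa> (Suc v) (Suc t) = side_excess \<kappa> v t
     + (\<Sum>i<v. card {j. i < j \<and> j < v \<and> side \<kappa> (\<not> \<kappa> i v) v i j \<le> t})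
     + (\<Sum>i<v. Suc t - side \<kappa> True (Suc v) i v) + (\<Sum>i<v. Suc t - side \<kappa> False (Suc v) i v)"
proof -
  let ?h = "\<lambda>n t i j. (t - side \<kappa> True n i j) + (t - side \<kappa> False n i j)"
  have row: "(\<Sum>j\<in>{i<..<Suc v}. ?h (Suc v) (Suc t) i j) =
      (\<Sum>j\<in>{i<..<v}. ?h v t i j) + card {j. i < j \<and> j < v \<and> side \<kappa> (\<not> \<kappa> i v) v i j \<le> t}
      + ?h (Suc v) (Suc t) i v" if "i < v" for i
  proof -
    have eq: "{i<..<Suc v} = insert v {i<..<v}" using that by auto
    have "(\<Sum>j\<in>{i<..<v}. ?h (Suc v) (Suc t) i j)
        = (\<Sum>j\<in>{i<..<v}. ?h v t i j + of_bool (side \<kappa> (\<not> \<kappa> i v) v i j \<le> t))"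
      by (intro sum.cong refl) (auto simp: side_Suc)
    also have "\<dots> = (\<Sum>j\<in>{i<..<v}. ?h v t i j)
        + (\<Sum>j\<in>{i<..<v}. of_bool (side \<kappa> (\<not> \<kappa> i v) v i j \<le> t))"
      by (simp add: sum.distrib)
    also have "(\<Sum>j\<in>{i<..<v}. of_bool (side \<kappa> (\<not> \<kappa> i v) v i j \<le> t) :: nat)
        = card ({i<..<v} \<inter> {j. side \<kappa> (\<not> \<kappa> i v) v i j \<le> t})"
      by (subst sum_of_bool_eq) auto
    also have "{i<..<v} \<inter> {j. side \<kappa> (\<not> \<kappa> i v) v i j \<le> t}
        = {j. i < j \<and> j < v \<and> side \<kappa> (\<not> \<kappa> i v) v i j \<le> t}" by auto
    finally show ?thesis by (simp add: eq)
  qed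
  have "side_excess \<kappa> (Suc v) (Suc t) = (\<Sum>i<v. \<Sum>j\<in>{i<..<Suc v}. ?h (Suc v) (Suc t) i j)"
    by (simp add: side_excess_def)
  also have "\<dots> = (\<Sum>i<v. (\<Sum>j\<in>{i<..<v}. ?h v t i j)
      + card {j. i < j \<and> j < v \<and> side \<kappa> (\<not> \<kappa> i v) v i j \<le> t} + ?h (Suc v) (Suc t) i v)"
    by (intro sum.cong refl row) simp
  finally show ?thesis
    by (simp add: sum.distrib side_excess_def)
qed

text \<open>Passing from \<open>t\<close> to \<open>t + 1\<close> adds
  \<open>3 * ((t + 1) * (t + 2))\<close> to the bound. The edges at the last vertex supply two
  thirds of this exactly, one third for each side, and \<open>card_row_side_ge\<close> supplies the
  rest.\<close>

lemma side_excess_ge: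
  assumes "2 * t + 2 \<le> n"
  shows "t * (t + 1) * (t + 2) \<le> 2 * side_excess \<kappa> n t"
  using assms
proof (induction t arbitrary: n)
  case (Suc t)
  then obtain v where v: "n = Suc v" by (cases n) auto
  have combine: "a + 3 * q \<le> 2 * (g + c + d + e)"
    if "a \<le> 2 * g" "q \<le> 2 * c" "2 * d = q" "2 * e = q" for a q g c d e :: nat
    using that by (simp add: distrib_left)
  have "(t + 1) * (t + 2) = 2 * (\<Sum>w<v. Suc t - w)"
    using double_sum_codiff_nat[of "Suc t" v] Suc.prems v by simp
  also have "\<dots> \<le> 2 * (\<Sum>i<v. card {j. i < j \<and> j < v \<and> side \<kappa> (\<not> \<kappa> i v) v i j \<le> t})"
  proof (intro mult_left_mono sum_mono)
    fix i
    \<comment> \<open>Rows with \<open>i > t\<close> need nothing, as \<open>Suc t - i\<close> is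
      then 0.\<close>
    show "Suc t - i \<le> card {j. i < j \<and> j < v \<and> side \<kappa> (\<not> \<kappa> i v) v i j \<le> t}"
      using card_row_side_ge[of i t v] Suc.prems v by (cases "i \<le> t") auto
  qed simp
  finally have rows: "(t + 1) * (t + 2)
      \<le> 2 * (\<Sum>i<v. card {j. i < j \<and> j < v \<and> side \<kappa> (\<not> \<kappa> i v) v i j \<le> t})" .
  have last: "2 * (\<Sum>i<v. Suc t - side \<kappa> x (Suc v) i v) = (t + 1) * (t + 2)" for x
    using sum_side_last[of "Suc t" v \<kappa> x] Suc.prems v by simp
  have IH: "t * (t + 1) * (t + 2) \<le> 2 * side_excess \<kappa> v t"
    using Suc.prems v by (intro Suc.IH) simp
  have "Suc t * (Suc t + 1) * (Suc t + 2) = t * (t + 1) * (t + 2) + 3 * ((t + 1) * (t + 2))"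
    by (simp add: algebra_simps)
  also have "\<dots> \<le> 2 * side_excess \<kappa> n (Suc t)"
    unfolding v side_excess_Suc by (rule combine[OF IH rows last last])
  finally show ?case .
qed simp

subsection \<open>Monochromatic quadruples: the lower bound\<close>

text \<open>\<open>?f\<close> puts the vertex on the left side first and \<open>?g\<close> sorts the
  pair again, which matches the separated pairs \<open>k < l\<close> with the product of the two
  sides.\<close>

lemma side_mult_side:
  assumes "i < j" "j < n"
  shows "side \<kappa> True n i j * side \<kappa> False n i j =
    card {(k, l). k < l \<and> l < n \<and> k \<notin> {i, j} \<and> l \<notin> {i, j} \<and> orient \<kappa> i j k \<noteq> orient \<kappa> i j l}"
    (is "_ = card ?S")
proof -
  let ?T = "side_set \<kappa> True n i j \<times> side_set \<kappa> False n i j"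
  let ?f = "\<lambda>(k, l). if orient \<kappa> i j k then (k, l) else (l, k)"
  let ?g = "\<lambda>(k, l). if k < l then (k, l) else (l, k :: nat)"
  have "bij_betw ?f ?S ?T"
    by (rule bij_betw_byWitness[where f' = ?g])
      (auto simp: side_set_def split: if_splits, (metis linorder_neqE_nat)+)
  then show ?thesis
    by (simp add: bij_betw_same_card card_cartesian_product)
qed

lemma sum_side_mult_side:
  "(\<Sum>i<n. \<Sum>j\<in>{i<..<n}. side \<kappa> True n i j * side \<kappa> False n i j) + card (mono_quads n \<kappa>)
    = 3 * card (quads n)"
proof -
  define P where "P i j k l \<longleftrightarrow> orient \<kappa> i j k \<noteq> orient \<kappa> i j l" for i j k l
  define W where "W = {(i, j, k, l). i < j \<and> j < n \<and> k < l \<and> l < n \<and> k \<notin> {i, j} \<and> l \<notin> {i, j} \<and> P i j k l}"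
  define Q where "Q f = {(a, b, c, d). (a, b, c, d) \<in> quads n \<and> f a b c d}"
    for f :: "nat \<Rightarrow> nat \<Rightarrow> nat \<Rightarrow> nat \<Rightarrow> bool"
  have finQ: "finite (Q f)" for f
    by (rule finite_subset[OF _ finite_quads[of n]]) (auto simp: Q_def)
  have cardQ: "card (Q f) = (\<Sum>(a, b, c, d)\<in>quads n. of_bool (f a b c d))" for f
  proof -
    have "(\<Sum>(a, b, c, d)\<in>quads n. of_bool (f a b c d) :: nat)
        = (\<Sum>q\<in>quads n. of_bool (case q of (a, b, c, d) \<Rightarrow> f a b c d))"
      by (intro sum.cong) auto
    also have "\<dots> = card (quads n \<inter> {q. case q of (a, b, c, d) \<Rightarrow> f a b c d})"
      by (subst sum_of_bool_eq) auto
    also have "quads n \<inter> {q. case q of (a, b, c, d) \<Rightarrow> f a b c d} = Q f"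
      by (auto simp: Q_def)
    finally show ?thesis ..
  qed
  have "(\<Sum>i<n. \<Sum>j\<in>{i<..<n}. side \<kappa> True n i j * side \<kappa> False n i j)
      = (\<Sum>i<n. \<Sum>j\<in>{i<..<n}. card {(k, l). (i, j, k, l) \<in> W})"
    by (intro sum.cong refl) (auto simp: side_mult_side W_def P_def intro!: arg_cong[where f = card])
  also have "\<dots> = (\<Sum>p\<in>(SIGMA i:{..<n}. {i<..<n}). card {(k, l). (fst p, snd p, k, l) \<in> W})"
    by (subst sum.Sigma) (auto simp: case_prod_unfold)
  also have "\<dots> = card (SIGMA p:(SIGMA i:{..<n}. {i<..<n}). {(k, l). (fst p, snd p, k, l) \<in> W})"
  proof (subst card_SigmaI)
    have "{(k, l). (i, j, k, l) \<in> W} \<subseteq> {..<n} \<times> {..<n}" for i j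
      by (auto simp: W_def)
    then have "finite {(k, l). (i, j, k, l) \<in> W}" for i j
      by (rule finite_subset) auto
    then show "\<forall>p\<in>SIGMA i:{..<n}. {i<..<n}. finite {(k, l). (fst p, snd p, k, l) \<in> W}"
      by auto
  qed auto
  also have "\<dots> = card W"
    by (rule bij_betw_same_card[OF bij_betw_byWitness[where f = "\<lambda>((i, j), (k, l)). (i, j, k, l)"
            and f' = "\<lambda>(i, j, k, l). ((i, j), (k, l))"]]) (auto simp: W_def)
  \<comment> \<open>A separation involves four distinct vertices. Sorted as
    \<open>a < b < c < d\<close>, its edge is one of the six pairs among them, which gives six
    disjoint pieces.\<close>
  also have "W = (\<lambda>(a, b, c, d). (a, b, c, d)) ` Q (\<lambda>a b c d. P a b c d)
      \<union> (\<lambda>(a, b, c, d). (a, c, b, d)) ` Q (\<lambda>a b c d. P a c b d)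
      \<union> (\<lambda>(a, b, c, d). (a, d, b, c)) ` Q (\<lambda>a b c d. P a d b c)
      \<union> (\<lambda>(a, b, c, d). (b, c, a, d)) ` Q (\<lambda>a b c d. P b c a d)
      \<union> (\<lambda>(a, b, c, d). (b, d, a, c)) ` Q (\<lambda>a b c d. P b d a c)
      \<union> (\<lambda>(a, b, c, d). (c, d, a, b)) ` Q (\<lambda>a b c d. P c d a b)" (is "_ = ?R")
  proof
    show "W \<subseteq> ?R"
    proof
      fix q assume q: "q \<in> W"
      obtain i j k l where "q = (i, j, k, l)" by (cases q)
      with q have ijkl: "(i, j, k, l) \<in> W" "q = (i, j, k, l)" by auto
      then consider "i < j" "j < k" "k < l" | "i < k" "k < j" "j < l" | "i < k" "k < l" "l < j"
        | "k < i" "i < j" "j < l" | "k < i" "i < l" "l < j" | "k < l" "l < i" "i < j"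
        by (auto simp: W_def) (metis linorder_neqE_nat)
      then show "q \<in> ?R"
        using ijkl by cases (force simp: W_def Q_def quads_def image_iff)+
    qed
    show "?R \<subseteq> W"
      by (auto simp: W_def Q_def quads_def)
  qed
  also have "card \<dots> = card (Q (\<lambda>a b c d. P a b c d)) + card (Q (\<lambda>a b c d. P a c b d))
      + card (Q (\<lambda>a b c d. P a d b c)) + card (Q (\<lambda>a b c d. P b c a d))
      + card (Q (\<lambda>a b c d. P b d a c)) + card (Q (\<lambda>a b c d. P c d a b))"
  proof -
    have six: "card (A \<union> B \<union> C \<union> D \<union> E \<union> F) = card A + card B + card C + card D + card E + card F"
      if "finite A" "finite B" "finite C" "finite D" "finite E" "finite F"
        "A \<inter> B = {}" "(A \<union> B) \<inter> C = {}" "(A \<union> B \<union> C) \<inter> D = {}" "(A \<union> B \<union> C \<union> D) \<inter> E = {}"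
        "(A \<union> B \<union> C \<union> D \<union> E) \<inter> F = {}"
      for A B C D E F :: "(nat \<times> nat \<times> nat \<times> nat) set"
      using that by (simp add: card_Un_disjoint)
    have img: "card (h ` Q f) = card (Q f)" if "inj h" for h :: "_ \<Rightarrow> nat \<times> nat \<times> nat \<times> nat" and f
      using that by (intro card_image) (auto intro: inj_on_subset)
    show ?thesis
      by (subst six) ((simp add: finQ; fail) | (auto simp: Q_def quads_def; fail) | (subst img, force simp: inj_def)+)+
  qed
  also have "\<dots> + card (mono_quads n \<kappa>) = 3 * card (quads n)"
  proof -
    have mono_eq: "mono_quads n \<kappa> = Q (\<lambda>a b c d. \<kappa> a c = \<kappa> b d)"
      by (auto simp: mono_quads_def Q_def quads_def)
    \<comment> \<open>The third indicator is 0, because \<open>b\<close> and \<open>c\<close> both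
      lie between \<open>a\<close> and \<open>d\<close>. The others form complementary pairs: the
      first two compare \<open>\<kappa> a c\<close> with \<open>\<kappa> a d\<close>, the fifth and
      sixth \<open>\<kappa> a d\<close> with \<open>\<kappa> b d\<close>, the fourth and seventh
      \<open>\<kappa> a c\<close> with \<open>\<kappa> b d\<close>.\<close>
    have "(\<Sum>(a, b, c, d)\<in>quads n. of_bool (P a b c d)) + (\<Sum>(a, b, c, d)\<in>quads n. of_bool (P a c b d))
      + (\<Sum>(a, b, c, d)\<in>quads n. of_bool (P a d b c)) + (\<Sum>(a, b, c, d)\<in>quads n. of_bool (P b c a d))
      + (\<Sum>(a, b, c, d)\<in>quads n. of_bool (P b d a c)) + (\<Sum>(a, b, c, d)\<in>quads n. of_bool (P c d a b))
      + (\<Sum>(a, b, c, d)\<in>quads n. of_bool (\<kappa> a c = \<kappa> b d)) = (\<Sum>q\<in>quads n. 3 :: nat)"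
      unfolding sum.distrib[symmetric]
      by (intro sum.cong) (auto simp: quads_def P_def orient_def)
    then show ?thesis unfolding mono_eq cardQ by simp
  qed
  finally show ?thesis .
qed

section \<open>Counts of increasing tuples and closed forms of sums\<close>

lemma card_pairs: "2 * int (card {(a, b). a < b \<and> b < (n::nat)}) = int n * (int n - 1)"
proof (induction n)
  case (Suc n)
  have fin: "finite {(a, b). a < b \<and> b < n}"
    by (rule finite_subset[of _ "{..<n} \<times> {..<n}"]) auto
  have "{(a, b). a < b \<and> b < Suc n} = {(a, b). a < b \<and> b < n} \<union> (\<lambda>a. (a, n)) ` {..<n}"
    by (auto simp: less_Suc_eq)
  moreover have "card ({(a, b). a < b \<and> b < n} \<union> (\<lambda>a. (a, n)) ` {..<n})
      = card {(a, b). a < b \<and> b < n} + card ((\<lambda>a. (a, n)) ` {..<n})"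
    using fin by (intro card_Un_disjoint) auto
  moreover have "card ((\<lambda>a. (a, n)) ` {..<n}) = n"
    by (subst card_image) (auto simp: inj_on_def)
  ultimately show ?case using Suc by (simp add: algebra_simps)
qed simp

lemma card_triples:
  "6 * int (card {(a, b, c). a < b \<and> b < c \<and> c < (n::nat)}) = int n * (int n - 1) * (int n - 2)"
proof (induction n)
  case (Suc n)
  have fin: "finite {(a, b, c). a < b \<and> b < c \<and> c < n}"
    by (rule finite_subset[of _ "{..<n} \<times> {..<n} \<times> {..<n}"]) auto
  have fin2: "finite {(a, b). a < b \<and> b < n}"
    by (rule finite_subset[of _ "{..<n} \<times> {..<n}"]) auto
  let ?f = "\<lambda>(a, b). (a, b, n)"
  have "{(a, b, c). a < b \<and> b < c \<and> c < Suc n}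
      = {(a, b, c). a < b \<and> b < c \<and> c < n} \<union> ?f ` {(a, b). a < b \<and> b < n}"
    by (auto simp: less_Suc_eq)
  moreover have "card ({(a, b, c). a < b \<and> b < c \<and> c < n} \<union> ?f ` {(a, b). a < b \<and> b < n})
      = card {(a, b, c). a < b \<and> b < c \<and> c < n} + card (?f ` {(a, b). a < b \<and> b < n})"
    using fin fin2 by (intro card_Un_disjoint) auto
  moreover have "card (?f ` {(a, b). a < b \<and> b < n}) = card {(a, b). a < b \<and> b < n}"
    by (intro card_image) (auto simp: inj_on_def)
  ultimately have "6 * int (card {(a, b, c). a < b \<and> b < c \<and> c < Suc n})
      = int n * (int n - 1) * (int n - 2) + 3 * (int n * (int n - 1))"
    using Suc card_pairs[of n] by simp
  then show ?case by (simp add: algebra_simps)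
qed simp

lemma card_quads: "24 * int (card (quads n)) = int n * (int n - 1) * (int n - 2) * (int n - 3)"
proof (induction n)
  case 0
  have "quads 0 = {}" by (auto simp: quads_def)
  then show ?case by simp
next
  case (Suc n)
  have fin: "finite {(a, b, c). a < b \<and> b < c \<and> c < n}"
    by (rule finite_subset[of _ "{..<n} \<times> {..<n} \<times> {..<n}"]) auto
  let ?f = "\<lambda>(a, b, c). (a, b, c, n)"
  have "quads (Suc n) = quads n \<union> ?f ` {(a, b, c). a < b \<and> b < c \<and> c < n}"
    by (auto simp: quads_def less_Suc_eq image_iff)
  moreover have "card (quads n \<union> ?f ` {(a, b, c). a < b \<and> b < c \<and> c < n})
      = card (quads n) + card (?f ` {(a, b, c). a < b \<and> b < c \<and> c < n})"
    using fin by (intro card_Un_disjoint finite_quads finite_imageI) (auto simp: quads_def)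
  moreover have "card (?f ` {(a, b, c). a < b \<and> b < c \<and> c < n}) = card {(a, b, c). a < b \<and> b < c \<and> c < n}"
    by (intro card_image) (auto simp: inj_on_def)
  ultimately have "24 * int (card (quads (Suc n)))
      = int n * (int n - 1) * (int n - 2) * (int n - 3) + 4 * (int n * (int n - 1) * (int n - 2))"
    using Suc card_triples[of n] by simp
  then show ?case by (simp add: algebra_simps)
qed

lemma sum_edges_const: "2 * (\<Sum>i<n. \<Sum>j\<in>{i<..<n}. K :: int) = int n * (int n - 1) * K"
proof -
  have "(\<Sum>i<n. \<Sum>j\<in>{i<..<n}. 1 :: int) = int (card (SIGMA i:{..<n}. {i<..<n}))"
    by (simp add: card_SigmaI)
  also have "(SIGMA i:{..<n}. {i<..<n}) = {(a, b). a < b \<and> b < n}" by auto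
  finally have "2 * (\<Sum>i<n. \<Sum>j\<in>{i<..<n}. 1 :: int) = int n * (int n - 1)"
    using card_pairs[of n] by simp
  moreover have "(\<Sum>i<n. \<Sum>j\<in>{i<..<n}. K :: int) = (\<Sum>i<n. \<Sum>j\<in>{i<..<n}. 1 :: int) * K"
    by (simp add: sum_distrib_right)
  ultimately show ?thesis by simp
qed

lemma sum_rising_factorial_3: "4 * (\<Sum>t\<le>M. int t * (int t + 1) * (int t + 2))
    = int M * (int M + 1) * (int M + 2) * (int M + 3)"
  by (induction M) (simp_all add: algebra_simps)

text \<open>With \<open>k = M - L\<close> for the smaller side \<open>L\<close>,
  \<open>L * R = (M - k) * (M + 1 + k) = M * (M + 1) - k * (k + 1)\<close>. The larger side exceeds
  \<open>M\<close>, so only the differences \<open>t - L\<close> survive, and they sum to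
  \<open>k * (k + 1) / 2\<close>.\<close>

lemma mult_eq_sum_diff_odd:
  fixes L R M :: nat
  assumes "L + R = 2 * M + 1"
  shows "int (L * R) = int M * (int M + 1) - 2 * (\<Sum>t\<le>M. int ((t - L) + (t - R)))"
  using assms
proof (induction L R rule: linorder_wlog)
  case (le L R)
  then have "L \<le> M" and R: "R = 2 * M + 1 - L" by auto
  then obtain k where k: "M = L + k" using le_Suc_ex by blast
  have "2 * (\<Sum>t\<le>M. (t - L) + (t - R)) = k * (k + 1)"
    unfolding sum.distrib distrib_left double_sum_diff_nat by (simp add: k R)
  then have "int (2 * (\<Sum>t\<le>M. (t - L) + (t - R))) = int (k * (k + 1))"
    by (simp only:)
  then have "2 * (\<Sum>t\<le>M. int ((t - L) + (t - R))) = int k * (int k + 1)"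
    by (simp add: distrib_left)
  moreover have "int R = int L + 2 * int k + 1" by (simp add: R k)
  ultimately show ?case by (simp add: k algebra_simps)
next
  case (sym L R)
  then show ?case by (simp add: add.commute mult.commute)
qed

text \<open>Here \<open>L * R = (M - k) * (M + k) = M * M - k * (k + 1) + k\<close>; the final
  \<open>k\<close> is the truncated difference at \<open>t = M\<close>, added back.\<close>

lemma mult_eq_sum_diff_even:
  fixes L R M :: nat
  assumes "L + R = 2 * M"
  shows "int (L * R) = int M * int M - 2 * (\<Sum>t\<le>M. int ((t - L) + (t - R))) + int ((M - L) + (M - R))"
  using assms
proof (induction L R rule: linorder_wlog)
  case (le L R)
  then have "L \<le> M" and R: "R = 2 * M - L" by auto
  then obtain k where k: "M = L + k" using le_Suc_ex by blast
  have "2 * (\<Sum>t\<le>M. (t - L) + (t - R)) = k * (k + 1)"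
    unfolding sum.distrib distrib_left double_sum_diff_nat by (simp add: k R)
  then have "int (2 * (\<Sum>t\<le>M. (t - L) + (t - R))) = int (k * (k + 1))"
    by (simp only:)
  then have "2 * (\<Sum>t\<le>M. int ((t - L) + (t - R))) = int k * (int k + 1)"
    by (simp add: distrib_left)
  moreover have "int R = int L + 2 * int k" by (simp add: R k)
  moreover have "(M - L) + (M - R) = k" by (simp add: R k)
  ultimately show ?case by (simp add: k algebra_simps)
next
  case (sym L R)
  then show ?case by (simp add: add.commute mult.commute)
qed

section \<open>Side products as combinations of side excesses, for odd and even
  \<open>n\<close>\<close>

lemma int_side_excess:
  "int (side_excess \<kappa> n t) = (\<Sum>i<n. \<Sum>j\<in>{i<..<n}. int ((t - side \<kappa> True n i j) + (t - side \<kappa> False n i j)))"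
  by (simp add: side_excess_def)

lemma int_sum_side_mult_side_odd:
  assumes "n = 2 * M + 3"
  shows "2 * int (\<Sum>i<n. \<Sum>j\<in>{i<..<n}. side \<kappa> True n i j * side \<kappa> False n i j)
    = int n * (int n - 1) * (int M * (int M + 1)) - 4 * (\<Sum>t\<le>M. int (side_excess \<kappa> n t))"
proof -
  let ?h = "\<lambda>t i j. int ((t - side \<kappa> True n i j) + (t - side \<kappa> False n i j))"
  have "int (side \<kappa> True n i j * side \<kappa> False n i j) = int M * (int M + 1) - 2 * (\<Sum>t\<le>M. ?h t i j)"
    if "i < j" "j < n" for i j
    using side_add_side[OF that, of \<kappa>] assms by (intro mult_eq_sum_diff_odd) simp
  then have "int (\<Sum>i<n. \<Sum>j\<in>{i<..<n}. side \<kappa> True n i j * side \<kappa> False n i j)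
      = (\<Sum>i<n. \<Sum>j\<in>{i<..<n}. int M * (int M + 1) - 2 * (\<Sum>t\<le>M. ?h t i j))"
    unfolding of_nat_sum by (intro sum.cong refl) auto
  also have "\<dots> = (\<Sum>i<n. \<Sum>j\<in>{i<..<n}. int M * (int M + 1)) - 2 * (\<Sum>i<n. \<Sum>j\<in>{i<..<n}. \<Sum>t\<le>M. ?h t i j)"
    unfolding sum_subtractf sum_distrib_left ..
  also have "(\<Sum>i<n. \<Sum>j\<in>{i<..<n}. \<Sum>t\<le>M. ?h t i j) = (\<Sum>t\<le>M. \<Sum>i<n. \<Sum>j\<in>{i<..<n}. ?h t i j)"
    by (subst sum.swap[of _ "{..M}"], subst (2) sum.swap) (rule refl)
  finally show ?thesis
    using sum_edges_const[where n = n and K = "int M * (int M + 1)"] unfolding int_side_excess by linarith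
qed

lemma int_sum_side_mult_side_even:
  assumes "n = 2 * M + 2"
  shows "2 * int (\<Sum>i<n. \<Sum>j\<in>{i<..<n}. side \<kappa> True n i j * side \<kappa> False n i j)
    = int n * (int n - 1) * (int M * int M) - 4 * (\<Sum>t\<le>M. int (side_excess \<kappa> n t))
      + 2 * int (side_excess \<kappa> n M)"
proof -
  let ?h = "\<lambda>t i j. int ((t - side \<kappa> True n i j) + (t - side \<kappa> False n i j))"
  have "int (side \<kappa> True n i j * side \<kappa> False n i j) = int M * int M - 2 * (\<Sum>t\<le>M. ?h t i j) + ?h M i j"
    if "i < j" "j < n" for i j
    using side_add_side[OF that, of \<kappa>] assms by (intro mult_eq_sum_diff_even) simp
  then have "int (\<Sum>i<n. \<Sum>j\<in>{i<..<n}. side \<kappa> True n i j * side \<kappa> False n i j)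
      = (\<Sum>i<n. \<Sum>j\<in>{i<..<n}. int M * int M - 2 * (\<Sum>t\<le>M. ?h t i j) + ?h M i j)"
    unfolding of_nat_sum by (intro sum.cong refl) auto
  also have "\<dots> = (\<Sum>i<n. \<Sum>j\<in>{i<..<n}. int M * int M) - 2 * (\<Sum>i<n. \<Sum>j\<in>{i<..<n}. \<Sum>t\<le>M. ?h t i j)
      + (\<Sum>i<n. \<Sum>j\<in>{i<..<n}. ?h M i j)"
    unfolding sum.distrib sum_subtractf sum_distrib_left ..
  also have "(\<Sum>i<n. \<Sum>j\<in>{i<..<n}. \<Sum>t\<le>M. ?h t i j) = (\<Sum>t\<le>M. \<Sum>i<n. \<Sum>j\<in>{i<..<n}. ?h t i j)"
    by (subst sum.swap[of _ "{..M}"], subst (2) sum.swap) (rule refl)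
  finally show ?thesis
    using sum_edges_const[where n = n and K = "int M * int M"] unfolding int_side_excess by linarith
qed

lemma int_side_excess_ge:
  assumes "2 * t + 2 \<le> n"
  shows "int t * (int t + 1) * (int t + 2) \<le> 2 * int (side_excess \<kappa> n t)"
proof -
  have "int (t * (t + 1) * (t + 2)) \<le> int (2 * side_excess \<kappa> n t)"
    using side_excess_ge[OF assms] by (simp only: of_nat_le_iff)
  then show ?thesis by (simp add: algebra_simps)
qed

text \<open>The excesses enter the sum of side products negatively, and that sum is subtracted from
  \<open>3 * card (quads n)\<close>. So lower bounds on the excesses for \<open>t \<le> M\<close>
  bound the number of monochromatic quadruples from below.\<close>

lemma card_mono_quads_ge_odd:
  assumes "n = 2 * M + 3"
  shows "int M * int M * (int M + 1) * (int M + 1) \<le> 4 * int (card (mono_quads n \<kappa>))"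
proof -
  define S where "S = (\<Sum>t\<le>M. int (side_excess \<kappa> n t))"
  have "(\<Sum>t\<le>M. int t * (int t + 1) * (int t + 2)) \<le> (\<Sum>t\<le>M. 2 * int (side_excess \<kappa> n t))"
    using assms by (intro sum_mono int_side_excess_ge) auto
  then have "int M * (int M + 1) * (int M + 2) * (int M + 3) \<le> 8 * S"
    unfolding S_def sum_distrib_left[symmetric] using sum_rising_factorial_3[of M] by simp
  moreover have "2 * int (\<Sum>i<n. \<Sum>j\<in>{i<..<n}. side \<kappa> True n i j * side \<kappa> False n i j)
      = int n * (int n - 1) * (int M * (int M + 1)) - 4 * S"
    unfolding S_def by (rule int_sum_side_mult_side_odd[OF assms])
  moreover have "int (\<Sum>i<n. \<Sum>j\<in>{i<..<n}. side \<kappa> True n i j * side \<kappa> False n i j)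
      + int (card (mono_quads n \<kappa>)) = 3 * int (card (quads n))"
    using arg_cong[OF sum_side_mult_side[of \<kappa> n], of int] by simp
  moreover note card_quads[of n]
  moreover have "int n = 2 * int M + 3" using assms by simp
  ultimately show ?thesis by (simp add: algebra_simps)
qed

lemma card_mono_quads_ge_even:
  assumes "n = 2 * M + 2"
  shows "(int M + 1) * int M * int M * (int M - 1) \<le> 4 * int (card (mono_quads n \<kappa>))"
proof -
  define S where "S = (\<Sum>t\<le>M. int (side_excess \<kappa> n t))"
  \<comment> \<open>The excess at \<open>M\<close> has half the weight of the others: \<open>- 4 * S
    + 2 * int (side_excess \<kappa> n M) = - 2 * S - 2 * S'\<close>. So \<open>S\<close> and
    \<open>S'\<close> are bounded separately.\<close>
  define S' where "S' = (\<Sum>t<M. int (side_excess \<kappa> n t))"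
  have SS: "S = S' + int (side_excess \<kappa> n M)"
    by (simp add: S_def S'_def lessThan_Suc_atMost[symmetric])
  have "(\<Sum>t\<le>M. int t * (int t + 1) * (int t + 2)) \<le> (\<Sum>t\<le>M. 2 * int (side_excess \<kappa> n t))"
    using assms by (intro sum_mono int_side_excess_ge) auto
  then have 1: "int M * (int M + 1) * (int M + 2) * (int M + 3) \<le> 8 * S"
    unfolding S_def sum_distrib_left[symmetric] using sum_rising_factorial_3[of M] by simp
  have "(\<Sum>t<M. int t * (int t + 1) * (int t + 2)) \<le> (\<Sum>t<M. 2 * int (side_excess \<kappa> n t))"
    using assms by (intro sum_mono int_side_excess_ge) auto
  \<comment> \<open>Dropping the term \<open>t = M\<close> from the closed form replaces its factor
    \<open>M + 3\<close> by \<open>M - 1\<close>.\<close>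
  then have 2: "int M * (int M + 1) * (int M + 2) * (int M - 1) \<le> 8 * S'"
    unfolding S'_def sum_distrib_left[symmetric]
    using sum_rising_factorial_3[of M] by (simp add: lessThan_Suc_atMost[symmetric] algebra_simps)
  have "2 * int (\<Sum>i<n. \<Sum>j\<in>{i<..<n}. side \<kappa> True n i j * side \<kappa> False n i j)
      = int n * (int n - 1) * (int M * int M) - 4 * S + 2 * int (side_excess \<kappa> n M)"
    unfolding S_def by (rule int_sum_side_mult_side_even[OF assms])
  moreover have "int (\<Sum>i<n. \<Sum>j\<in>{i<..<n}. side \<kappa> True n i j * side \<kappa> False n i j)
      + int (card (mono_quads n \<kappa>)) = 3 * int (card (quads n))"
    using arg_cong[OF sum_side_mult_side[of \<kappa> n], of int] by simp
  moreover note card_quads[of n]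
  moreover have "int n = 2 * int M + 2" using assms by simp
  ultimately show ?thesis using 1 2 SS by (simp add: algebra_simps)
qed

subsection \<open>Monochromatic quadruples: the averaging bound\<close>

lemma inj_on_add_mod: "inj_on (\<lambda>h. (p + h) mod n) {..<n::nat}"
proof (rule linorder_inj_onI)
  fix h k assume "h < k" "k \<in> {..<n}"
  then have "\<not> n dvd (p + k) - (p + h)" by (auto dest: dvd_imp_le)
  then show "(p + h) mod n \<noteq> (p + k) mod n"
    using \<open>h < k\<close> by (metis add_le_cancel_left less_imp_le mod_eq_dvd_iff_nat)
qed auto

text \<open>The residues \<open>r = (p + h) mod n\<close> are distinct for distinct
  \<open>h\<close>, so it suffices to count the \<open>r\<close> that the shift by \<open>s\<close>
  keeps in the same half.\<close>

lemma card_same_half_le: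
  assumes "0 < s" "s < n"
  shows "int (card {h. h < n \<and> ((p + h) mod n < n div 2) = ((p + s + h) mod n < n div 2)}) \<le> \<bar>int n - 2 * int s\<bar>"
proof -
  define m where "m = n div 2"
  have m: "2 * m \<le> n" "n \<le> 2 * m + 1" by (auto simp: m_def)
  have "card {h. h < n \<and> ((p + h) mod n < m) = ((p + s + h) mod n < m)}
      \<le> card {r. r < n \<and> (r < m) = ((r + s) mod n < m)}"
  proof (rule card_inj_on_le)
    show "inj_on (\<lambda>h. (p + h) mod n) {h. h < n \<and> ((p + h) mod n < m) = ((p + s + h) mod n < m)}"
      by (rule inj_on_subset[OF inj_on_add_mod]) auto
    have "((p + h) mod n + s) mod n = (p + s + h) mod n" for h
      using mod_add_left_eq[of "p + h" n s] by (simp only: ac_simps)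
    then show "(\<lambda>h. (p + h) mod n) ` {h. h < n \<and> ((p + h) mod n < m) = ((p + s + h) mod n < m)}
        \<subseteq> {r. r < n \<and> (r < m) = ((r + s) mod n < m)}"
      using assms by auto
  qed auto
  moreover have shift: "(r + s) mod n = (if r + s < n then r + s else r + s - n)" if "r < n" for r
    using that assms by (simp add: mod_if)
  have "int (card {r. r < n \<and> (r < m) = ((r + s) mod n < m)}) \<le> \<bar>int n - 2 * int s\<bar>"
  proof (cases "s \<le> m")
    case True
    \<comment> \<open>Agreement means staying in the lower half or in the upper half without
      wrapping: a wrapped sum falls below \<open>s \<le> m\<close>, whereas its \<open>r\<close> is
      at least \<open>n - s \<ge> m\<close>.\<close>
    then have "{r. r < n \<and> (r < m) = ((r + s) mod n < m)} \<subseteq> {..<m - s} \<union> {m..<n - s}"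
      using shift m by (auto split: if_splits)
    then have "card {r. r < n \<and> (r < m) = ((r + s) mod n < m)} \<le> card ({..<m - s} \<union> {m..<n - s})"
      by (intro card_mono) auto
    also have "\<dots> \<le> (m - s) + (n - s - m)"
      using card_Un_le[of "{..<m - s}" "{m..<n - s}"] by simp
    finally show ?thesis using True m by linarith
  next
    case False
    \<comment> \<open>Now agreement requires wrapping past \<open>n\<close>, with \<open>r\<close>
      and \<open>r + s - n\<close> both below \<open>m\<close> or both at least
      \<open>m\<close>.\<close>
    then have "{r. r < n \<and> (r < m) = ((r + s) mod n < m)} \<subseteq> {n - s..<m} \<union> {n + m - s..<n}"
      using shift m assms by (auto split: if_splits)
    then have "card {r. r < n \<and> (r < m) = ((r + s) mod n < m)} \<le> card ({n - s..<m} \<union> {n + m - s..<n})"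
      by (intro card_mono) auto
    also have "\<dots> \<le> (m - (n - s)) + (n - (n + m - s))"
      using card_Un_le[of "{n - s..<m}" "{n + m - s..<n}"] by simp
    finally show ?thesis using False m assms by linarith
  qed
  ultimately show ?thesis unfolding m_def by linarith
qed

text \<open>Here \<open>s = (b + d) - (a + c)\<close> is the shift between the index sums of
  \<open>ac\<close> and \<open>bd\<close>. There are \<open>s - 1\<close> choices for
  \<open>x = b - a\<close>; closing up both gaps leaves a pair \<open>a < e\<close> below
  \<open>n - s\<close>.\<close>

lemma card_quads_gap:
  assumes "0 < s" "s < n"
  shows "2 * int (card {(a, b, c, d) \<in> quads n. (b - a) + (d - c) = s})
    = (int s - 1) * (int n - int s) * (int n - int s - 1)"
proof -
  let ?f = "\<lambda>(a, b, c, d). (b - a, a, c - (b - a))"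
  let ?g = "\<lambda>(x, a, e). (a, a + x, e + x, e + s)"
  have "card {(a, b, c, d) \<in> quads n. (b - a) + (d - c) = s}
      = card ({1..<s} \<times> {(a, e). a < e \<and> e < n - s})"
    by (rule bij_betw_same_card[OF bij_betw_byWitness[where f = ?f and f' = ?g]])
      (auto simp: quads_def)
  then have "2 * int (card {(a, b, c, d) \<in> quads n. (b - a) + (d - c) = s})
      = int (s - 1) * (2 * int (card {(a, e). a < e \<and> e < n - s}))"
    by (simp add: card_cartesian_product)
  then show ?thesis
    using assms unfolding card_pairs by (simp add: of_nat_diff algebra_simps)
qed

section \<open>Evaluation of the average over all rotations\<close>

lemma sum_quads_gap:
  fixes w :: "nat \<Rightarrow> int"
  shows "2 * (\<Sum>(a, b, c, d)\<in>quads n. w ((b - a) + (d - c)))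
    = (\<Sum>s\<in>{1..<n}. (int s - 1) * (int n - int s) * (int n - int s - 1) * w s)"
proof -
  let ?s = "\<lambda>(a, b, c, d). (b - a) + (d - c) :: nat"
  have "(\<Sum>(a, b, c, d)\<in>quads n. w ((b - a) + (d - c))) = (\<Sum>q\<in>quads n. w (?s q))"
    by (intro sum.cong) auto
  also have "\<dots> = (\<Sum>s\<in>{1..<n}. \<Sum>q\<in>{q \<in> quads n. ?s q = s}. w (?s q))"
    by (rule sum.group[symmetric]) (simp, simp, auto simp: quads_def)
  also have "\<dots> = (\<Sum>s\<in>{1..<n}. int (card {(a, b, c, d) \<in> quads n. (b - a) + (d - c) = s}) * w s)"
  proof (intro sum.cong refl)
    fix s
    have "{q \<in> quads n. ?s q = s} = {(a, b, c, d) \<in> quads n. (b - a) + (d - c) = s}"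
      by auto
    moreover have "(\<Sum>q\<in>{q \<in> quads n. ?s q = s}. w (?s q)) = (\<Sum>q\<in>{q \<in> quads n. ?s q = s}. w s)"
      by (intro sum.cong) auto
    ultimately show "(\<Sum>q\<in>{q \<in> quads n. ?s q = s}. w (?s q))
        = int (card {(a, b, c, d) \<in> quads n. (b - a) + (d - c) = s}) * w s"
      by simp
  qed
  finally have "2 * (\<Sum>(a, b, c, d)\<in>quads n. w ((b - a) + (d - c)))
      = (\<Sum>s\<in>{1..<n}. (2 * int (card {(a, b, c, d) \<in> quads n. (b - a) + (d - c) = s})) * w s)"
    by (simp add: sum_distrib_left mult.assoc)
  also have "\<dots> = (\<Sum>s\<in>{1..<n}. (int s - 1) * (int n - int s) * (int n - int s - 1) * w s)"
  proof (rule sum.cong[OF refl])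
    fix s assume "s \<in> {1..<n}"
    then have "0 < s" "s < n" by simp_all
    from card_quads_gap[OF this]
    show "(2 * int (card {(a, b, c, d) \<in> quads n. (b - a) + (d - c) = s})) * w s
        = (int s - 1) * (int n - int s) * (int n - int s - 1) * w s"
      by (simp only:)
  qed
  finally show ?thesis .
qed

lemma sum_telescope_gap:
  "2 * (\<Sum>s\<in>{1..K}. (int s - 1) * (N - int s - 1) * (N - 2 * int s))
    = int K * (int K - 1) * (N - int K - 2) * (N - int K - 1)"
proof (induction K)
  case (Suc K)
  have "2 * (\<Sum>s\<in>{1..Suc K}. (int s - 1) * (N - int s - 1) * (N - 2 * int s))
      = int K * (int K - 1) * (N - int K - 2) * (N - int K - 1)
        + 2 * (int K * (N - int K - 2) * (N - 2 * int K - 2))"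
    using Suc by (simp add: algebra_simps)
  also have "\<dots> = int (Suc K) * (int (Suc K) - 1) * (N - int (Suc K) - 2) * (N - int (Suc K) - 1)"
    by (simp add: algebra_simps)
  finally show ?case .
qed simp

text \<open>\<open>4 Z(n)\<close>: with \<open>m = \<lfloor>n/2\<rfloor>\<close> the other three floors are \<open>m - 1\<close>, \<open>n - m - 2\<close> and \<open>n - m - 1\<close>.\<close>

definition Z4 :: "nat \<Rightarrow> int" where
  "Z4 n = (let m = int (n div 2) in m * (m - 1) * (int n - m - 2) * (int n - m - 1))"

lemma sum_gap_eq_Z4:
  "(\<Sum>s\<in>{1..<n}. (int s - 1) * (int n - int s - 1) * \<bar>int n - 2 * int s\<bar>) = Z4 n"
proof (cases "n = 0")
  case False
  define m where "m = n div 2"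
  have m: "2 * m \<le> n" "n \<le> 2 * m + 1" by (auto simp: m_def)
  let ?\<psi> = "\<lambda>s. (int s - 1) * (int n - int s - 1) * \<bar>int n - 2 * int s\<bar>"
  have half: "2 * (\<Sum>s\<in>{1..K}. ?\<psi> s) = int K * (int K - 1) * (int n - int K - 2) * (int n - int K - 1)"
    if "2 * K \<le> n" for K
  proof -
    have "(\<Sum>s\<in>{1..K}. ?\<psi> s) = (\<Sum>s\<in>{1..K}. (int s - 1) * (int n - int s - 1) * (int n - 2 * int s))"
      using that by (intro sum.cong refl) auto
    then show ?thesis by (simp only: sum_telescope_gap)
  qed
  have split: "{1..<n} = {1..m} \<union> {m+1..<n}"
    using m False by auto
  have "(\<Sum>s\<in>{1..<n}. ?\<psi> s) = (\<Sum>s\<in>{1..m}. ?\<psi> s) + (\<Sum>s\<in>{m+1..<n}. ?\<psi> s)"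
    unfolding split by (rule sum.union_disjoint) auto
  also have "(\<Sum>s\<in>{m+1..<n}. ?\<psi> s) = (\<Sum>s\<in>{1..n - m - 1}. ?\<psi> s)"
    by (rule sum.reindex_bij_witness[where i = "\<lambda>s. n - s" and j = "\<lambda>s. n - s"])
      (auto simp: of_nat_diff algebra_simps abs_if)
  finally have "2 * (\<Sum>s\<in>{1..<n}. ?\<psi> s) = 2 * (\<Sum>s\<in>{1..m}. ?\<psi> s) + 2 * (\<Sum>s\<in>{1..n - m - 1}. ?\<psi> s)"
    by simp
  also have "\<dots> = 2 * Z4 n"
  proof -
    have "int (n - m - 1) = int n - int m - 1" "2 * (n - m - 1) \<le> n"
      using m False by auto
    then show ?thesis
      using half[of m] half[of "n - m - 1"] m(1)
      by (simp add: Z4_def Let_def m_def[symmetric] algebra_simps)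
  qed
  finally show ?thesis by simp
qed (simp add: Z4_def)

text \<open>Adding the sum reflected by \<open>s\<close> to \<open>n - s\<close> turns the factor
  \<open>n - s\<close> into \<open>(n - s) + s = n\<close>, leaving the weights of
  \<open>sum_gap_eq_Z4\<close>.\<close>

lemma sum_gap_symmetrize:
  "2 * (\<Sum>s\<in>{1..<n}. (int s - 1) * (int n - int s) * (int n - int s - 1) * \<bar>int n - 2 * int s\<bar>) = int n * Z4 n"
proof -
  let ?F = "\<lambda>s. (int s - 1) * (int n - int s) * (int n - int s - 1) * \<bar>int n - 2 * int s\<bar>"
  let ?G = "\<lambda>s. (int n - int s - 1) * int s * (int s - 1) * \<bar>int n - 2 * int s\<bar>"
  have "(\<Sum>s\<in>{1..<n}. ?F s) = (\<Sum>s\<in>{1..<n}. ?G s)"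
  proof (rule sum.reindex_bij_witness[where i = "\<lambda>s. n - s" and j = "\<lambda>s. n - s"])
    fix s assume "s \<in> {1..<n}"
    then have "int (n - s) = int n - int s" by auto
    then show "?G (n - s) = ?F s" by (simp add: algebra_simps abs_if)
  qed auto
  then have "2 * (\<Sum>s\<in>{1..<n}. ?F s) = (\<Sum>s\<in>{1..<n}. ?F s + ?G s)"
    by (simp add: sum.distrib)
  also have "\<dots> = (\<Sum>s\<in>{1..<n}. int n * ((int s - 1) * (int n - int s - 1) * \<bar>int n - 2 * int s\<bar>))"
    by (intro sum.cong refl) (simp add: algebra_simps)
  also have "\<dots> = int n * Z4 n"
    by (simp only: sum_distrib_left[symmetric] sum_gap_eq_Z4)
  finally show ?thesis .
qed

lemma exists_colouring_mono_quads_le: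
  assumes "n \<ge> 1"
  shows "\<exists>\<kappa>. 4 * int (card (mono_quads n \<kappa>)) \<le> Z4 n"
proof (rule ccontr)
  assume contra: "\<nexists>\<kappa>. 4 * int (card (mono_quads n \<kappa>)) \<le> Z4 n"
  \<comment> \<open>Summing over all rotations \<open>h\<close>, a quadruple is monochromatic for \<open>|n - 2s|\<close> values of \<open>h\<close>,
    where \<open>s\<close> is the sum of two opposite gaps; the average number is \<open>Z4 n / 4\<close>.\<close>
  define \<kappa> where "\<kappa> h i j \<longleftrightarrow> (i + j + h) mod n < n div 2" for h i j :: nat
  \<comment> \<open>By integrality every rotation would contribute at least \<open>Z4 n + 1\<close>,
    whereas the total is at most \<open>n * Z4 n\<close>.\<close>
  have "int n * (Z4 n + 1) = (\<Sum>h<n. Z4 n + 1)" by simp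
  also have "\<dots> \<le> (\<Sum>h<n. 4 * int (card (mono_quads n (\<kappa> h))))"
  proof (rule sum_mono)
    fix h
    show "Z4 n + 1 \<le> 4 * int (card (mono_quads n (\<kappa> h)))"
      using contra by (meson not_le zless_imp_add1_zle)
  qed
  also have "\<dots> = 4 * (\<Sum>h<n. \<Sum>(a, b, c, d)\<in>quads n. of_bool (\<kappa> h a c = \<kappa> h b d))"
  proof -
    have "int (card (mono_quads n \<kappa>')) = (\<Sum>(a, b, c, d)\<in>quads n. of_bool (\<kappa>' a c = \<kappa>' b d))" for \<kappa>'
    proof -
      have "mono_quads n \<kappa>' = quads n \<inter> {q. case q of (a, b, c, d) \<Rightarrow> \<kappa>' a c = \<kappa>' b d}"
        by (auto simp: mono_quads_def quads_def)
      then have "int (card (mono_quads n \<kappa>')) = (\<Sum>q\<in>quads n. of_bool (case q of (a, b, c, d) \<Rightarrow> \<kappa>' a c = \<kappa>' b d))"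
        by (simp add: sum_of_bool_eq)
      also have "\<dots> = (\<Sum>(a, b, c, d)\<in>quads n. of_bool (\<kappa>' a c = \<kappa>' b d))"
        by (intro sum.cong) auto
      finally show ?thesis .
    qed
    then show ?thesis by (simp add: sum_distrib_left)
  qed
  also have "(\<Sum>h<n. \<Sum>(a, b, c, d)\<in>quads n. of_bool (\<kappa> h a c = \<kappa> h b d) :: int)
      = (\<Sum>q\<in>quads n. \<Sum>h<n. case q of (a, b, c, d) \<Rightarrow> of_bool (\<kappa> h a c = \<kappa> h b d))"
    by (rule sum.swap)
  also have "4 * \<dots> \<le> 4 * (\<Sum>(a, b, c, d)\<in>quads n. \<bar>int n - 2 * int ((b - a) + (d - c))\<bar>)"
  proof (intro mult_left_mono sum_mono)
    fix q assume q: "q \<in> quads n"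
    obtain a b c d where abcd: "q = (a, b, c, d)" by (cases q)
    let ?s = "(b - a) + (d - c)"
    have ord: "a < b" "b < c" "c < d" "d < n" using q abcd by (auto simp: quads_def)
    \<comment> \<open>The index sums \<open>a + c\<close> and \<open>b + d\<close> differ by
      \<open>?s\<close>, so the residues deciding the two colours rotate together at a fixed
      distance.\<close>
    then have s: "0 < ?s" "?s < n" "a + c + ?s = b + d" by auto
    have "(\<Sum>h<n. of_bool (\<kappa> h a c = \<kappa> h b d) :: int) = int (card ({..<n} \<inter> {h. \<kappa> h a c = \<kappa> h b d}))"
      by (simp add: sum_of_bool_eq)
    also have "{..<n} \<inter> {h. \<kappa> h a c = \<kappa> h b d}
        = {h. h < n \<and> ((a + c + h) mod n < n div 2) = ((a + c + ?s + h) mod n < n div 2)}"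
      unfolding s(3) by (auto simp: \<kappa>_def)
    also have "int (card \<dots>) \<le> \<bar>int n - 2 * int ?s\<bar>"
      by (rule card_same_half_le[OF s(1,2)])
    finally show "(\<Sum>h<n. case q of (a, b, c, d) \<Rightarrow> of_bool (\<kappa> h a c = \<kappa> h b d))
        \<le> (case q of (a, b, c, d) \<Rightarrow> \<bar>int n - 2 * int ((b - a) + (d - c))\<bar>)"
      unfolding abcd by simp
  qed simp
  also have "\<dots> = int n * Z4 n"
    using sum_quads_gap[of "\<lambda>s. \<bar>int n - 2 * int s\<bar>" n] sum_gap_symmetrize[of n] by linarith
  finally show False using assms by (simp add: algebra_simps)
qed

lemma card_mono_quads_ge:
  assumes "n \<ge> 1"
  shows "Z4 n \<le> 4 * int (card (mono_quads n \<kappa>))"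
proof (cases "n = 1")
  case True
  then show ?thesis by (simp add: Z4_def)
next
  case False
  define M where "M = (n - 2) div 2"
  from False assms have "n = 2 * M + 2 \<or> n = 2 * M + 3"
    unfolding M_def by presburger
  then show ?thesis
  proof
    assume n: "n = 2 * M + 2"
    then have "int (n div 2) = int M + 1" by simp
    with n have "Z4 n = (int M + 1) * int M * int M * (int M - 1)"
      by (simp add: Z4_def Let_def algebra_simps)
    then show ?thesis using card_mono_quads_ge_even[OF n, of \<kappa>] by simp
  next
    assume n: "n = 2 * M + 3"
    then have "int (n div 2) = int M + 1" by simp
    with n have "Z4 n = int M * int M * (int M + 1) * (int M + 1)"
      by (simp add: Z4_def Let_def algebra_simps)
    then show ?thesis using card_mono_quads_ge_odd[OF n, of \<kappa>] by simp
  qed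
qed

subsection \<open>Drawings\<close>

lemma paths_meet_upper_half_plane:
  fixes f g :: "real \<Rightarrow> complex"
  assumes "path f" "path g"
    and ends: "pathstart f = of_real a" "pathfinish f = of_real c" "pathstart g = of_real b" "pathfinish g = of_real d"
    and upper: "path_image f \<subseteq> {z. Im z \<ge> 0}" "path_image g \<subseteq> {z. Im z \<ge> 0}"
    and "a < b" "b < c" "c < d"
  shows "path_image f \<inter> path_image g \<noteq> {}"
proof -
  define T :: "complex \<Rightarrow> real^2" where "T z = vector [Re z, Im z]" for z
  have T: "T z $ 1 = Re z" "T z $ 2 = Im z" for z by (simp_all add: T_def)
  have contT: "continuous_on UNIV T"
    unfolding continuous_on_componentwise[where 'b = "real^2"] Basis_vec_def
    by (auto simp: inner_axis forall_2 T intro!: continuous_intros)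
  have injT: "T z = T w \<longleftrightarrow> z = w" for z w
    by (metis T complex_eqI)
  have "bounded (path_image f \<union> path_image g)"
    using assms by (simp add: compact_imp_bounded compact_path_image)
  then obtain B where B: "\<And>z. z \<in> path_image f \<union> path_image g \<Longrightarrow> norm z \<le> B"
    unfolding bounded_iff by blast
  \<comment> \<open>The lower side of this box lies on the spine, so the four ends lie on that side
    in interlaced order, as \<open>fashoda_interlace\<close> requires.\<close>
  define lo hi :: "real^2" where "lo = vector [-B, 0]" and "hi = vector [B, B]"
  have box: "T ` path_image h \<subseteq> cbox lo hi" if sub: "path_image h \<subseteq> path_image f \<union> path_image g" for h
  proof
    fix p assume "p \<in> T ` path_image h"
    then obtain z where z: "p = T z" "z \<in> path_image f \<union> path_image g" using sub by blast
    then have "\<bar>Re z\<bar> \<le> B" "\<bar>Im z\<bar> \<le> B" "Im z \<ge> 0"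
      using B[of z] abs_Re_le_cmod[of z] abs_Im_le_cmod[of z] upper by auto
    then show "p \<in> cbox lo hi"
      by (auto simp: z mem_box_cart forall_2 T lo_def hi_def abs_le_iff)
  qed
  obtain z where "z \<in> path_image (T \<circ> f)" "z \<in> path_image (T \<circ> g)"
  proof (rule fashoda_interlace[of "T \<circ> f" "T \<circ> g" lo hi])
    show "path (T \<circ> f)" "path (T \<circ> g)"
      using assms contT by (auto intro!: path_continuous_image intro: continuous_on_subset)
    show "path_image (T \<circ> f) \<subseteq> cbox lo hi" "path_image (T \<circ> g) \<subseteq> cbox lo hi"
      using box[of f] box[of g] by (auto simp: path_image_compose)
  qed (use assms in \<open>simp_all add: pathstart_compose pathfinish_compose T lo_def\<close>)
  then show ?thesis
    by (auto simp: path_image_compose injT)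
qed

lemma paths_meet_page:
  fixes f g :: "real \<Rightarrow> complex"
  assumes "path f" "path g"
    and "pathstart f = of_real a" "pathfinish f = of_real c" "pathstart g = of_real b" "pathfinish g = of_real d"
    and "path_image f \<subseteq> page x" "path_image g \<subseteq> page x"
    and "a < b" "b < c" "c < d"
  shows "path_image f \<inter> path_image g \<noteq> {}"
proof (cases x)
  case True
  then show ?thesis
    using assms by (intro paths_meet_upper_half_plane[of f g a c b d]) (auto simp: page_def)
next
  case False
  \<comment> \<open>Conjugation carries the lower page to the upper one and fixes the spine.\<close>
  have "path_image (cnj \<circ> f) \<inter> path_image (cnj \<circ> g) \<noteq> {}"
  proof (rule paths_meet_upper_half_plane[of _ _ a c b d])
    show "path (cnj \<circ> f)" "path (cnj \<circ> g)"
      using assms by (auto intro!: path_continuous_image continuous_intros)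
  qed (use assms False in \<open>auto simp: pathstart_compose pathfinish_compose path_image_compose page_def\<close>)
  then show ?thesis by (auto simp: path_image_compose)
qed

text \<open>A drawing leaves the direction of each arc open; reversing the arc where necessary gives
  a path from \<open>i\<close> to \<open>j\<close> with the same image.\<close>

lemma two_page_drawing_edge:
  assumes "two_page_drawing n pos g pg" "i < n" "j < n" "i \<noteq> j"
  obtains h where "path h" "path_image h = path_image (g {i, j})"
    "pathstart h = of_real (pos i)" "pathfinish h = of_real (pos j)"
    "path_image (g {i, j}) \<subseteq> page (pg {i, j})"
    "arc_interior (g {i, j}) = path_image (g {i, j}) - {of_real (pos i), of_real (pos j)}"
    "path_image (g {i, j}) \<inter> (\<lambda>v. complex_of_real (pos v)) ` {..<n} = {of_real (pos i), of_real (pos j)}"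
proof -
  let ?e = "{i, j}"
  have "?e \<in> Kn_edges n" using assms by (auto simp: Kn_edges_def)
  then have e: "arc (g ?e)" "path_image (g ?e) \<subseteq> page (pg ?e)"
      "\<exists>i' j'. ?e = {i', j'} \<and> pathstart (g ?e) = complex_of_real (pos i') \<and> pathfinish (g ?e) = complex_of_real (pos j')"
      "path_image (g ?e) \<inter> (\<lambda>v. complex_of_real (pos v)) ` {..<n} = {pathstart (g ?e), pathfinish (g ?e)}"
    using assms(1) unfolding two_page_drawing_def by blast+
  then consider "pathstart (g ?e) = of_real (pos i)" "pathfinish (g ?e) = of_real (pos j)"
    | "pathstart (g ?e) = of_real (pos j)" "pathfinish (g ?e) = of_real (pos i)"
    by (auto simp: doubleton_eq_iff)
  then show ?thesis
  proof cases
    case 1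
    with e show ?thesis by (intro that[of "g ?e"]) (auto simp: arc_imp_path arc_interior_def)
  next
    case 2
    with e show ?thesis
      by (intro that[of "reversepath (g ?e)"]) (auto simp: arc_imp_path arc_interior_def)
  qed
qed

lemma alternating_edges_cross:
  assumes "two_page_drawing n pos g pg" "i < n" "j < n" "k < n" "l < n"
    and ord: "pos i < pos k" "pos k < pos j" "pos j < pos l"
    and same: "pg {i, j} = pg {k, l}"
  shows "\<exists>p. p \<in> arc_interior (g {i, j}) \<and> p \<in> arc_interior (g {k, l})"
proof -
  have "i \<noteq> j" "k \<noteq> l" using ord by auto
  obtain f where f: "path f" "path_image f = path_image (g {i, j})"
    "pathstart f = of_real (pos i)" "pathfinish f = of_real (pos j)"
    "path_image (g {i, j}) \<subseteq> page (pg {i, j})"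
    "arc_interior (g {i, j}) = path_image (g {i, j}) - {of_real (pos i), of_real (pos j)}"
    "path_image (g {i, j}) \<inter> (\<lambda>v. complex_of_real (pos v)) ` {..<n} = {of_real (pos i), of_real (pos j)}"
    using two_page_drawing_edge[OF assms(1-3) \<open>i \<noteq> j\<close>] .
  obtain h where h: "path h" "path_image h = path_image (g {k, l})"
    "pathstart h = of_real (pos k)" "pathfinish h = of_real (pos l)"
    "path_image (g {k, l}) \<subseteq> page (pg {k, l})"
    "arc_interior (g {k, l}) = path_image (g {k, l}) - {of_real (pos k), of_real (pos l)}"
    "path_image (g {k, l}) \<inter> (\<lambda>v. complex_of_real (pos v)) ` {..<n} = {of_real (pos k), of_real (pos l)}"
    using two_page_drawing_edge[OF assms(1,4,5) \<open>k \<noteq> l\<close>] .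
  have "path_image f \<inter> path_image h \<noteq> {}"
    using f h ord same by (intro paths_meet_page[of f h "pos i" "pos j" "pos k" "pos l" "pg {k, l}"]) auto
  then obtain p where p: "p \<in> path_image (g {i, j})" "p \<in> path_image (g {k, l})"
    using f h by auto
  \<comment> \<open>A common vertex would be an end of both edges, but alternating edges have four
    distinct ends. So the meeting point is interior to both arcs, as \<open>crossings\<close>
    demands.\<close>
  have vert: "p \<noteq> of_real (pos v)" if "v < n" for v
  proof
    assume "p = of_real (pos v)"
    then have "p \<in> {of_real (pos i), of_real (pos j)}" "p \<in> {of_real (pos k), of_real (pos l)}"
      using p f(7) h(7) that by blast+
    then show False using ord by auto
  qed
  then show ?thesis using p f(6) h(6) assms(2-5) by auto
qed

text \<open>The numbering of the vertices need not follow the spine; \<open>\<sigma> a\<close> is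
  the vertex in place \<open>a\<close>, and the colouring is read off after this
  renumbering.\<close>

lemma exists_sorting:
  fixes pos :: "nat \<Rightarrow> real"
  assumes "inj_on pos {..<n}"
  shows "\<exists>\<sigma>. (\<forall>a<n. \<sigma> a < n) \<and> (\<forall>a b. a < b \<longrightarrow> b < n \<longrightarrow> pos (\<sigma> a) < pos (\<sigma> b))"
proof -
  define xs where "xs = sorted_list_of_set (pos ` {..<n})"
  define \<sigma> where "\<sigma> a = inv_into {..<n} pos (xs ! a)" for a
  have len: "length xs = n"
    using assms by (simp add: xs_def card_image)
  have mem: "xs ! a \<in> pos ` {..<n}" if "a < n" for a
    using that len nth_mem[of a xs] by (simp add: xs_def)
  have "\<sigma> a < n" "pos (\<sigma> a) = xs ! a" if "a < n" for a
    using inv_into_into[OF mem[OF that]] f_inv_into_f[OF mem[OF that]] by (auto simp: \<sigma>_def)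
  moreover have "xs ! a < xs ! b" if "a < b" "b < n" for a b
    using that len strict_sorted_list_of_set[of "pos ` {..<n}"]
    by (auto simp: xs_def intro: sorted_wrt_nth_less)
  ultimately show ?thesis
    by (intro exI[of _ \<sigma>]) auto
qed

text \<open>The union of the two pairs, sorted, recovers the quadruple. So a crossing, which records
  its edges without order, comes from only one quadruple.\<close>

lemma alternating_pairs_unique:
  fixes a b c d :: "'a :: linorder"
  assumes "{{a, c}, {b, d}} = {{a', c'}, {b', d'}}"
    and "a < b" "b < c" "c < d" "a' < b'" "b' < c'" "c' < d'"
  shows "a = a' \<and> b = b' \<and> c = c' \<and> d = d'"
  using assms by (auto simp: doubleton_eq_iff)

lemma mono_quads_le_crossings:
  assumes draw: "two_page_drawing n pos g pg" and fin: "finite (crossings n g)"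
  shows "\<exists>\<kappa>. card (mono_quads n \<kappa>) \<le> card (crossings n g)"
proof -
  obtain \<sigma> where \<sigma>: "\<And>a. a < n \<Longrightarrow> \<sigma> a < n"
    and mono: "\<And>a b. a < b \<Longrightarrow> b < n \<Longrightarrow> pos (\<sigma> a) < pos (\<sigma> b)"
    using exists_sorting[of pos n] draw unfolding two_page_drawing_def by blast
  have inj: "a = b" if "pos (\<sigma> a) = pos (\<sigma> b)" "a < n" "b < n" for a b
    using that mono[of a b] mono[of b a] by (metis less_irrefl linorder_neqE_nat)
  define \<kappa> where "\<kappa> a b = pg {\<sigma> a, \<sigma> b}" for a b
  have "\<exists>p. p \<in> arc_interior (g {\<sigma> a, \<sigma> c}) \<and> p \<in> arc_interior (g {\<sigma> b, \<sigma> d})"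
    if "(a, b, c, d) \<in> mono_quads n \<kappa>" for a b c d
    using that by (intro alternating_edges_cross[OF draw] \<sigma> mono) (auto simp: mono_quads_def \<kappa>_def)
  then obtain P where P: "\<And>a b c d. (a, b, c, d) \<in> mono_quads n \<kappa> \<Longrightarrow>
      P a b c d \<in> arc_interior (g {\<sigma> a, \<sigma> c}) \<and> P a b c d \<in> arc_interior (g {\<sigma> b, \<sigma> d})"
    by metis
  define F where "F = (\<lambda>(a, b, c, d). (P a b c d, {{\<sigma> a, \<sigma> c}, {\<sigma> b, \<sigma> d}}))"
  have "inj_on F (mono_quads n \<kappa>)"
  proof (rule inj_onI)
    fix q q' assume qq: "q \<in> mono_quads n \<kappa>" "q' \<in> mono_quads n \<kappa>" "F q = F q'"
    obtain a b c d where q: "q = (a, b, c, d)" by (cases q)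
    obtain a' b' c' d' where q': "q' = (a', b', c', d')" by (cases q')
    have "{{\<sigma> a, \<sigma> c}, {\<sigma> b, \<sigma> d}} = {{\<sigma> a', \<sigma> c'}, {\<sigma> b', \<sigma> d'}}"
      using qq(3) by (simp add: F_def q q')
    \<comment> \<open>Spine positions are linearly ordered along the quadruples, so the pair of
      edges alone determines the quadruple, whatever the point.\<close>
    from arg_cong[OF this, of "image (image pos)"]
    have eq: "{{pos (\<sigma> a), pos (\<sigma> c)}, {pos (\<sigma> b), pos (\<sigma> d)}}
        = {{pos (\<sigma> a'), pos (\<sigma> c')}, {pos (\<sigma> b'), pos (\<sigma> d')}}"
      by simp
    have ord: "a < b" "b < c" "c < d" "d < n" "a' < b'" "b' < c'" "c' < d'" "d' < n"
      using qq(1,2) by (auto simp: q q' mono_quads_def)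
    have "pos (\<sigma> a) = pos (\<sigma> a') \<and> pos (\<sigma> b) = pos (\<sigma> b') \<and> pos (\<sigma> c) = pos (\<sigma> c') \<and> pos (\<sigma> d) = pos (\<sigma> d')"
      using ord by (intro alternating_pairs_unique[OF eq] mono) auto
    then show "q = q'"
      unfolding q q' using ord inj by auto
  qed
  moreover have "F ` mono_quads n \<kappa> \<subseteq> crossings n g"
  proof
    fix y assume "y \<in> F ` mono_quads n \<kappa>"
    then obtain a b c d where q: "(a, b, c, d) \<in> mono_quads n \<kappa>" and y: "y = F (a, b, c, d)"
      by auto
    then have ord: "a < b" "b < c" "c < d" "d < n" by (auto simp: mono_quads_def)
    have ne: "\<sigma> s \<noteq> \<sigma> t" if "s < t" "t < n" for s t
      using mono[OF that] by auto
    have "{\<sigma> a, \<sigma> c} \<in> Kn_edges n" "{\<sigma> b, \<sigma> d} \<in> Kn_edges n"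
      using ord \<sigma> ne[of a c] ne[of b d] unfolding Kn_edges_def by (auto intro!: exI)
    moreover have "{\<sigma> a, \<sigma> c} \<noteq> {\<sigma> b, \<sigma> d}"
      using ord ne[of a b] ne[of a d] by (auto simp: doubleton_eq_iff)
    ultimately show "y \<in> crossings n g"
      using P[OF q] unfolding y F_def crossings_def by auto
  qed
  \<comment> \<open>Finiteness matters here: \<open>card\<close> of an infinite set of crossings
    would be 0.\<close>
  ultimately show ?thesis
    using fin card_inj_on_le by blast
qed

section \<open>Parabolic drawings\<close>

text \<open>Subtracting the equations of two parabolas with the same leading coefficient leaves a linear
  equation, so two arcs on the same page meet at most once.\<close>

definition parabola :: "bool \<Rightarrow> real \<Rightarrow> real \<Rightarrow> real \<Rightarrow> complex" where
  "parabola u i j x = Complex x ((if u then 1 else -1) * ((x - i) * (j - x)))"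

definition parabolic_arc :: "(nat \<Rightarrow> nat \<Rightarrow> bool) \<Rightarrow> nat set \<Rightarrow> real \<Rightarrow> complex" where
  "parabolic_arc \<kappa> e t = (let i = Min e; j = Max e in
     parabola (\<kappa> i j) (real i) (real j) (real i + t * (real j - real i)))"

lemma Kn_edgeE:
  assumes "e \<in> Kn_edges n"
  obtains i j where "e = {i, j}" "i < j" "j < n"
proof -
  obtain i j where "e = {i, j}" "i < n" "j < n" "i \<noteq> j"
    using assms by (auto simp: Kn_edges_def)
  then show ?thesis
    using that[of i j] that[of j i] by (cases "i < j") (auto simp: insert_commute)
qed

context
  fixes i j :: nat
  assumes ij: "i < j"
begin

lemma parabolic_arc_pair:
  "parabolic_arc \<kappa> {i, j} = (\<lambda>t. parabola (\<kappa> i j) (real i) (real j) (real i + t * (real j - real i)))"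
  using ij by (auto simp: parabolic_arc_def Let_def)

lemma parabolic_arc_ends:
  "pathstart (parabolic_arc \<kappa> {i, j}) = of_real (real i)"
  "pathfinish (parabolic_arc \<kappa> {i, j}) = of_real (real j)"
  by (simp_all add: parabolic_arc_pair parabola_def pathstart_def pathfinish_def complex_eq_iff)

lemma arc_parabolic_arc: "arc (parabolic_arc \<kappa> {i, j})"
proof -
  have "continuous_on {0..1} (\<lambda>t. parabola u (real i) (real j) (real i + t * (real j - real i)))" for u
    unfolding parabola_def Complex_eq by (intro continuous_intros)
  then show ?thesis
    using ij by (auto simp: arc_def path_def parabolic_arc_pair inj_on_def parabola_def)
qed

lemma path_image_parabolic_arc:
  "path_image (parabolic_arc \<kappa> {i, j}) = parabola (\<kappa> i j) (real i) (real j) ` {real i..real j}"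
proof -
  have "(\<lambda>t. real i + t * (real j - real i)) ` {0..1} = {real i..real j}"
    using ij image_affinity_atLeastAtMost[of "real j - real i" "real i" 0 1] by (simp add: ac_simps)
  then show ?thesis
    unfolding path_image_def parabolic_arc_pair by (metis image_image)
qed

lemma arc_interior_parabolic_arc:
  "arc_interior (parabolic_arc \<kappa> {i, j}) = parabola (\<kappa> i j) (real i) (real j) ` {real i<..<real j}"
proof -
  have "{real i..real j} = insert (real i) (insert (real j) {real i<..<real j})"
    using ij by auto
  then show ?thesis
    unfolding arc_interior_def path_image_parabolic_arc parabolic_arc_ends
    by (auto simp: parabola_def complex_eq_iff)
qed

end

lemma two_page_drawing_parabolic_arc:
  "two_page_drawing n real (parabolic_arc \<kappa>) (\<lambda>e. \<kappa> (Min e) (Max e))"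
  unfolding two_page_drawing_def
proof (intro conjI ballI)
  show "inj_on real {..<n}" by (simp add: inj_on_def)
  fix e assume "e \<in> Kn_edges n"
  then obtain i j where e: "e = {i, j}" "i < j" "j < n" by (rule Kn_edgeE)
  have mm: "Min e = i" "Max e = j" using e by auto
  have nonneg: "(x - real i) * (real j - x) \<ge> 0" if "x \<in> {real i..real j}" for x
    using that by simp
  show "arc (parabolic_arc \<kappa> e)" using arc_parabolic_arc e by simp
  show "path_image (parabolic_arc \<kappa> e) \<subseteq> page (\<kappa> (Min e) (Max e))"
    using nonneg e(2) unfolding mm unfolding e(1)
    by (auto simp: path_image_parabolic_arc page_def parabola_def)
  show "\<exists>i j. e = {i, j} \<and> pathstart (parabolic_arc \<kappa> e) = complex_of_real (real i) \<and>
      pathfinish (parabolic_arc \<kappa> e) = complex_of_real (real j)"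
    using parabolic_arc_ends[OF e(2), of \<kappa>] e(1) by blast
  \<comment> \<open>The height of the arc vanishes only at its ends, so it meets no other
    vertex.\<close>
  have "parabola u (real i) (real j) x = complex_of_real (real v) \<Longrightarrow> x = real i \<or> x = real j" for u x v
    by (auto simp: parabola_def complex_eq_iff split: if_splits)
  then show "path_image (parabolic_arc \<kappa> e) \<inter> (\<lambda>v. complex_of_real (real v)) ` {..<n}
      = {pathstart (parabolic_arc \<kappa> e), pathfinish (parabolic_arc \<kappa> e)}"
    unfolding e(1) path_image_parabolic_arc[OF e(2)] parabolic_arc_ends[OF e(2)]
    using e(2,3) by (fastforce simp: parabola_def complex_eq_iff image_iff)
qed

lemma signed_eq_pos:
  fixes A B :: real
  assumes "(if P then 1 else -1) * A = (if Q then 1 else -1) * B" "A > 0" "B > 0"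
  shows "P = Q \<and> A = B"
  using assms by (auto split: if_splits)

text \<open>If \<open>l \<le> j\<close>, then \<open>x - k < x - i\<close> and
  \<open>l - x \<le> j - x\<close> put the second parabola strictly below the first. Hence
  \<open>j < l\<close>, and the linear equation left after cancelling squares has the nonzero
  coefficient \<open>i + j - k - l\<close>.\<close>

lemma parabolas_alternate:
  fixes i j k l x :: real
  assumes "(x - i) * (j - x) = (x - k) * (l - x)" "i < x" "x < j" "k < x" "x < l" "i < k"
  shows "j < l \<and> x = (i * j - k * l) / (i + j - k - l)"
proof -
  have "j < l"
  proof (rule ccontr)
    assume "\<not> j < l"
    then have "(x - k) * (l - x) < (x - i) * (j - x)"
      using assms by (intro mult_less_le_imp_less) auto
    then show False using assms(1) by simp
  qed
  moreover have "x * (i + j - k - l) = i * j - k * l"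
    using assms(1) by (simp add: algebra_simps)
  ultimately show ?thesis using assms(6) by (auto simp: field_simps)
qed

text \<open>The abscissa is the one found in \<open>parabolas_alternate\<close>. As every crossing
  is a value of this function on a monochromatic quadruple, finiteness and the bound on their number
  follow together.\<close>

definition parabola_crossing :: "(nat \<Rightarrow> nat \<Rightarrow> bool) \<Rightarrow> nat \<times> nat \<times> nat \<times> nat \<Rightarrow> complex \<times> nat set set" where
  "parabola_crossing \<kappa> = (\<lambda>(a, b, c, d).
     (parabola (\<kappa> a c) (real a) (real c)
        ((real a * real c - real b * real d) / (real a + real c - real b - real d)), {{a, c}, {b, d}}))"

lemma parabolic_arcs_cross:
  assumes ord: "i < j" "j < n" "k < l" "l < n" "i < k"
    and p: "p \<in> arc_interior (parabolic_arc \<kappa> {i, j})" "p \<in> arc_interior (parabolic_arc \<kappa> {k, l})"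
  shows "(p, {{i, j}, {k, l}}) \<in> parabola_crossing \<kappa> ` mono_quads n \<kappa>"
proof -
  obtain x where x: "p = parabola (\<kappa> i j) (real i) (real j) x" "real i < x" "x < real j"
    using p(1) ord by (auto simp: arc_interior_parabolic_arc)
  obtain y where y: "p = parabola (\<kappa> k l) (real k) (real l) y" "real k < y" "y < real l"
    using p(2) ord by (auto simp: arc_interior_parabolic_arc)
  have "y = x" using x y by (simp add: parabola_def)
  note y = y[unfolded this]
  have pos: "(x - real i) * (real j - x) > 0" "(x - real k) * (real l - x) > 0"
    using x y by simp_all
  have "(if \<kappa> i j then 1 else -1) * ((x - real i) * (real j - x))
      = (if \<kappa> k l then 1 else -1) * ((x - real k) * (real l - x))"
    using x(1) y(1) by (simp add: parabola_def)
  then have same: "\<kappa> i j = \<kappa> k l" and eq: "(x - real i) * (real j - x) = (x - real k) * (real l - x)"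
    using signed_eq_pos pos by blast+
  have "j < l" and xeq: "x = (real i * real j - real k * real l) / (real i + real j - real k - real l)"
    using parabolas_alternate[OF eq] x y ord by auto
  moreover have "k < j" using x y by linarith
  ultimately have "(i, k, j, l) \<in> mono_quads n \<kappa>"
    using ord same by (auto simp: mono_quads_def)
  moreover have "(p, {{i, j}, {k, l}}) = parabola_crossing \<kappa> (i, k, j, l)"
    unfolding x(1) parabola_crossing_def xeq by simp
  ultimately show ?thesis by (rule rev_image_eqI)
qed

lemma crossings_parabolic_arc:
  "crossings n (parabolic_arc \<kappa>) \<subseteq> parabola_crossing \<kappa> ` mono_quads n \<kappa>"
proof
  fix y assume "y \<in> crossings n (parabolic_arc \<kappa>)"
  then obtain p e f where y: "y = (p, {e, f})" "e \<in> Kn_edges n" "f \<in> Kn_edges n" "e \<noteq> f"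
    "p \<in> arc_interior (parabolic_arc \<kappa> e)" "p \<in> arc_interior (parabolic_arc \<kappa> f)"
    by (auto simp: crossings_def)
  obtain i j where e: "e = {i, j}" "i < j" "j < n" using y(2) by (rule Kn_edgeE)
  obtain k l where f: "f = {k, l}" "k < l" "l < n" using y(3) by (rule Kn_edgeE)
  consider "i < k" | "k < i" | "i = k" by linarith
  then show "y \<in> parabola_crossing \<kappa> ` mono_quads n \<kappa>"
  proof cases
    case 1
    then show ?thesis using parabolic_arcs_cross[of i j n k l p \<kappa>] y e f by simp
  next
    case 2
    then show ?thesis using parabolic_arcs_cross[of k l n i j p \<kappa>] y e f by (simp add: insert_commute)
  next
    \<comment> \<open>At a common left end, cancelling \<open>x - i > 0\<close> gives
      \<open>j = l\<close>. A common right end is settled by the first two cases, where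
      \<open>parabolas_alternate\<close> makes the right ends distinct.\<close>
    case 3
    obtain x where x: "p = parabola (\<kappa> i j) (real i) (real j) x" "real i < x"
      using y(5) e by (auto simp: arc_interior_parabolic_arc)
    obtain x' where x': "p = parabola (\<kappa> k l) (real k) (real l) x'" "x' < real l"
      using y(6) f by (auto simp: arc_interior_parabolic_arc)
    have "x' = x" using x x' by (simp add: parabola_def)
    moreover have "x < real j" using y(5) e x by (auto simp: arc_interior_parabolic_arc parabola_def)
    ultimately have "(x - real i) * (real j - x) > 0" "(x - real i) * (real l - x) > 0"
      using x x' by auto
    moreover have "Im p = (if \<kappa> i j then 1 else -1) * ((x - real i) * (real j - x))"
      unfolding x(1) by (simp add: parabola_def)
    moreover have "Im p = (if \<kappa> k l then 1 else -1) * ((x - real i) * (real l - x))"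
      unfolding x'(1) using 3 \<open>x' = x\<close> by (simp add: parabola_def)
    ultimately have "(x - real i) * (real j - x) = (x - real i) * (real l - x)"
      using signed_eq_pos by metis
    then have "j = l" using x by simp
    then show ?thesis using y(4) e f 3 by simp
  qed
qed

section \<open>The floors and the conclusion\<close>

lemma floor_products_eq_Z4:
  "\<lfloor>real n / 2\<rfloor> * \<lfloor>(real n - 1) / 2\<rfloor> * \<lfloor>(real n - 2) / 2\<rfloor> * \<lfloor>(real n - 3) / 2\<rfloor> = Z4 n"
proof -
  define m where "m = n div 2"
  have "n = 2 * m \<or> n = 2 * m + 1" unfolding m_def by presburger
  then have "\<lfloor>real n / 2\<rfloor> = int m" "\<lfloor>(real n - 1) / 2\<rfloor> = int n - int m - 1"
      "\<lfloor>(real n - 2) / 2\<rfloor> = int m - 1" "\<lfloor>(real n - 3) / 2\<rfloor> = int n - int m - 2"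
    by (auto intro!: floor_unique)
  then show ?thesis by (simp add: Z4_def Let_def m_def[symmetric] mult_ac)
qed

theorem theorem7:
  fixes n :: nat
  assumes "n \<ge> 1"
  shows "real (nu2_complete n) =
    1/4 * real_of_int (\<lfloor>real n / 2\<rfloor> * \<lfloor>(real n - 1) / 2\<rfloor>
                     * \<lfloor>(real n - 2) / 2\<rfloor> * \<lfloor>(real n - 3) / 2\<rfloor>)"
proof -
  let ?P = "\<lambda>k. \<exists>pos g pg. two_page_drawing n pos g pg \<and> finite (crossings n g) \<and> card (crossings n g) = k"
  obtain \<kappa> where \<kappa>: "4 * int (card (mono_quads n \<kappa>)) \<le> Z4 n"
    using exists_colouring_mono_quads_le[OF assms] by blast
  define k where "k = card (crossings n (parabolic_arc \<kappa>))"
  have fin: "finite (crossings n (parabolic_arc \<kappa>))"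
    using crossings_parabolic_arc by (rule finite_subset) simp
  have "k \<le> card (mono_quads n \<kappa>)"
    unfolding k_def using crossings_parabolic_arc by (rule surj_card_le[rotated]) simp
  with \<kappa> have upper: "4 * int k \<le> Z4 n" by linarith
  have lower: "Z4 n \<le> 4 * int k'" if drawing: "?P k'" for k'
  proof -
    obtain \<kappa>' where "card (mono_quads n \<kappa>') \<le> k'"
      using drawing mono_quads_le_crossings by metis
    then show ?thesis using card_mono_quads_ge[OF assms, of \<kappa>'] by linarith
  qed
  have drawing: "?P k"
    using two_page_drawing_parabolic_arc fin k_def by blast
  \<comment> \<open>The parabolic drawing obeys the lower bound too, so equality holds; in
    particular \<open>Z4 n\<close> is divisible by 4.\<close>
  have "4 * int k = Z4 n"
    using upper lower[OF drawing] by linarith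
  then have "real_of_int (4 * int k) = real_of_int (Z4 n)"
    by (simp only:)
  moreover have "nu2_complete n = k"
    unfolding nu2_complete_def
  proof (rule Least_equality)
    show "k \<le> k'" if "?P k'" for k'
      using lower[OF that] upper by linarith
  qed (fact drawing)
  ultimately show ?thesis
    unfolding floor_products_eq_Z4 by simp
qed

end
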